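(* Let $d\ge 2$ and let $\varphi\in GL(d,\mathbb{Z})$ have infinite order. Then there exists $n_0$ such that the rank of $G_n=\mathbb{Z}^d\rtimes_{\varphi^n}\mathbb{Z}$ is at least $3$ for all $n\ge n_0$.
   Context: For a group $A$ and $\psi\in \mathrm{Aut}(A)$, $A\rtimes_\psi\mathbb{Z}=\langle A,t\mid tat^{-1}=\psi(a)\ (a\in A)\rangle$. The rank of a finitely generated group is the minimum cardinality of a generating set. *)

theory Defs
  imports
    "HOL-Algebra.Bij"
    "HOL-Algebra.Generated_Groups"
    "Jordan_Normal_Form.Matrix"
begin

text \<open>
  The rank is only meaningful for finitely generated groups; if no finite generating set exists,
  the \<^verbatim>\<open>LEAST\<close> is an unspecified number.
\<close>

definition group_rank :: "('a, 'b) monoid_scheme \<Rightarrow> nat" where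
  "group_rank G =
     (LEAST k. \<exists>S. S \<subseteq> carrier G \<and> finite S \<and> card S = k \<and> generate G S = carrier G)"

text \<open>
  The semidirect product of \<^term>\<open>A\<close> with the integers along \<^term>\<open>\<psi>\<close>: the pair \<^verbatim>\<open>(a, m)\<close>
  stands for the element \<^verbatim>\<open>a t^m\<close>, and \<^verbatim>\<open>t^m b t^(-m)\<close> is the \<^verbatim>\<open>m\<close>-th power of
  \<^term>\<open>\<psi>\<close> (taken in the automorphism group of \<^term>\<open>A\<close>, so \<^verbatim>\<open>m\<close> may be negative) applied
  to \<^verbatim>\<open>b\<close>. The lemmas \<^verbatim>\<open>semidirect_int_conj\<close> and \<^verbatim>\<open>semidirect_int_universal\<close>
  below show that this group has the presentation
  \<^verbatim>\<open>< A, t | t a t^(-1) = psi(a) for a in A >\<close>.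
\<close>

definition semidirect_int :: "('a, 'b) monoid_scheme \<Rightarrow> ('a \<Rightarrow> 'a) \<Rightarrow> ('a \<times> int) monoid" where
  "semidirect_int A \<psi> =
     \<lparr>carrier = carrier A \<times> UNIV,
      monoid.mult = (\<lambda>(a, m) (b, n). (a \<otimes>\<^bsub>A\<^esub> (\<psi> [^]\<^bsub>AutoGroup A\<^esub> m) b, m + n)),
      one = (\<one>\<^bsub>A\<^esub>, 0)\<rparr>"

definition GL_int :: "nat \<Rightarrow> int mat monoid" where
  "GL_int d = units_of (ring_mat TYPE(int) d ())"

text \<open>
  The restriction to the carrier is needed because the elements of \<^verbatim>\<open>AutoGroup\<close> are extensional
  functions.
\<close>

definition mat_automorphism :: "nat \<Rightarrow> int mat \<Rightarrow> int vec \<Rightarrow> int vec" where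
  "mat_automorphism d M = (\<lambda>v \<in> carrier_vec d. M *\<^sub>v v)"

lemma mat_automorphism_in_auto:
  assumes "M \<in> carrier (GL_int d)"
  shows "mat_automorphism d M \<in> auto (monoid_vec TYPE(int) d)"
proof -
  from assms obtain N where M: "M \<in> carrier_mat d d" and N: "N \<in> carrier_mat d d"
    and NM: "N * M = 1\<^sub>m d" and MN: "M * N = 1\<^sub>m d"
    by (auto simp: GL_int_def units_of_def Units_def ring_mat_simps)
  have "bij_betw (mat_automorphism d M) (carrier_vec d) (carrier_vec d)"
  proof (rule bij_betw_byWitness[where f' = "\<lambda>v. N *\<^sub>v v"])
    show "\<forall>v\<in>carrier_vec d. N *\<^sub>v (mat_automorphism d M v) = v"
      using M N NM
      by (auto simp: mat_automorphism_def assoc_mult_mat_vec[symmetric, of _ d d _ d])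
    show "\<forall>v\<in>carrier_vec d. mat_automorphism d M (N *\<^sub>v v) = v"
      using M N MN
      by (auto simp: mat_automorphism_def assoc_mult_mat_vec[symmetric, of _ d d _ d])
    show "mat_automorphism d M ` carrier_vec d \<subseteq> carrier_vec d"
      using M by (auto simp: mat_automorphism_def)
    show "(\<lambda>v. N *\<^sub>v v) ` carrier_vec d \<subseteq> carrier_vec d"
      using N by auto
  qed
  then show ?thesis
    using M
    by (auto simp: auto_def Bij_def hom_def mat_automorphism_def monoid_vec_simps
        mult_add_distrib_mat_vec[of _ d d])
qed

lemma AutoGroup_simps:
  "carrier (AutoGroup A) = auto A"
  "\<one>\<^bsub>AutoGroup A\<^esub> = (\<lambda>x \<in> carrier A. x)"
  "f \<in> auto A \<Longrightarrow> g \<in> auto A \<Longrightarrow> f \<otimes>\<^bsub>AutoGroup A\<^esub> g = compose (carrier A) f g"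
  by (auto simp: AutoGroup_def BijGroup_def auto_def)

lemma auto_apply:
  assumes "f \<in> auto A"
  shows "x \<in> carrier A \<Longrightarrow> f x \<in> carrier A"
    and "x \<in> carrier A \<Longrightarrow> y \<in> carrier A \<Longrightarrow> f (x \<otimes>\<^bsub>A\<^esub> y) = f x \<otimes>\<^bsub>A\<^esub> f y"
  using assms by (auto simp: auto_def hom_def)

context
  fixes A (structure) and \<psi>
  assumes A: "group A" and \<psi>: "\<psi> \<in> auto A"
begin

interpretation A: group A by (rule A)
interpretation Aut: group "AutoGroup A" by (rule A.AutoGroup)

private abbreviation pw :: "int \<Rightarrow> 'a \<Rightarrow> 'a" where
  "pw m \<equiv> \<psi> [^]\<^bsub>AutoGroup A\<^esub> m"

private lemma pw_auto: "pw m \<in> auto A"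
  using Aut.int_pow_closed[of \<psi> m] \<psi> by (simp add: AutoGroup_simps)

private lemma pw_closed [simp]: "a \<in> carrier A \<Longrightarrow> pw m a \<in> carrier A"
  using auto_apply(1)[OF pw_auto] .

private lemma pw_mult:
  "a \<in> carrier A \<Longrightarrow> b \<in> carrier A \<Longrightarrow> pw m (a \<otimes> b) = pw m a \<otimes> pw m b"
  using auto_apply(2)[OF pw_auto] .

private lemma pw_add: "a \<in> carrier A \<Longrightarrow> pw (m + n) a = pw m (pw n a)"
  using Aut.int_pow_mult[of \<psi> m n] \<psi> AutoGroup_simps(3)[OF pw_auto[of m] pw_auto[of n]]
  by (simp add: AutoGroup_simps(1) compose_def)

private lemma Aut_one_apply [simp]: "a \<in> carrier A \<Longrightarrow> \<one>\<^bsub>AutoGroup A\<^esub> a = a"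
  by (simp add: AutoGroup_simps(2))

private lemma pw_1 [simp]: "pw 1 = \<psi>"
  using Aut.int_pow_1[of \<psi>] \<psi> by (simp add: AutoGroup_simps(1))

private lemma pw_one [simp]: "pw m \<one> = \<one>"
  using pw_mult[of \<one> \<one> m] A.r_cancel_one'[of "pw m \<one>" "pw m \<one>"] by simp

lemma group_semidirect_int: "group (semidirect_int A \<psi>)"
proof (rule groupI)
  fix x assume "x \<in> carrier (semidirect_int A \<psi>)"
  then obtain a m where x: "x = (a, m)" "a \<in> carrier A"
    by (auto simp: semidirect_int_def)
  have "(pw (-m) (inv a), -m) \<otimes>\<^bsub>semidirect_int A \<psi>\<^esub> x = \<one>\<^bsub>semidirect_int A \<psi>\<^esub>"
    using x pw_mult[of "inv a" a "-m"] by (simp add: semidirect_int_def)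
  then show "\<exists>y\<in>carrier (semidirect_int A \<psi>). y \<otimes>\<^bsub>semidirect_int A \<psi>\<^esub> x = \<one>\<^bsub>semidirect_int A \<psi>\<^esub>"
    using x by (intro bexI[of _ "(pw (-m) (inv a), -m)"]) (auto simp: semidirect_int_def)
qed (auto simp: semidirect_int_def pw_mult pw_add A.m_assoc)

lemma semidirect_int_inclusion: "(\<lambda>a. (a, 0)) \<in> hom A (semidirect_int A \<psi>)"
  by (auto simp: hom_def semidirect_int_def)

lemma semidirect_int_conj:
  assumes a: "a \<in> carrier A"
  shows "(\<one>, 1) \<otimes>\<^bsub>semidirect_int A \<psi>\<^esub> (a, 0) \<otimes>\<^bsub>semidirect_int A \<psi>\<^esub> inv\<^bsub>semidirect_int A \<psi>\<^esub> (\<one>, 1)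
    = (\<psi> a, 0)"
proof -
  interpret S: group "semidirect_int A \<psi>" by (rule group_semidirect_int)
  have "(\<one>, 1) \<otimes>\<^bsub>semidirect_int A \<psi>\<^esub> (a, 0) = (\<psi> a, 0) \<otimes>\<^bsub>semidirect_int A \<psi>\<^esub> (\<one>, 1)"
    using a auto_apply(1)[OF \<psi> a] by (simp add: semidirect_int_def)
  then show ?thesis
    using a auto_apply(1)[OF \<psi> a]
    by (intro S.inv_solve_right'[THEN iffD2]) (auto simp: semidirect_int_def)
qed

private lemma semidirect_int_pow: "(\<one>, 1) [^]\<^bsub>semidirect_int A \<psi>\<^esub> (m::int) = (\<one>, m)"
proof -
  interpret S: group "semidirect_int A \<psi>" by (rule group_semidirect_int)
  have t: "(\<one>, 1) \<in> carrier (semidirect_int A \<psi>)" by (simp add: semidirect_int_def)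
  have m: "(\<one>, k) \<otimes>\<^bsub>semidirect_int A \<psi>\<^esub> (\<one>, l) = (\<one>, k + l)" for k l
    by (simp add: semidirect_int_def)
  have o: "\<one>\<^bsub>semidirect_int A \<psi>\<^esub> = (\<one>, 0)"
    by (simp add: semidirect_int_def)
  have n: "(\<one>, 1) [^]\<^bsub>semidirect_int A \<psi>\<^esub> (k::nat) = (\<one>, int k)" for k
  proof (induction k)
    case 0
    show ?case by (simp only: S.nat_pow_0 o of_nat_0)
  next
    case (Suc k)
    show ?case by (simp only: S.nat_pow_Suc Suc.IH m of_nat_Suc add.commute)
  qed
  show ?thesis
  proof (cases "m \<ge> 0")
    case True
    then obtain k where "m = int k" by (rule nonneg_int_cases)
    then show ?thesis by (simp only: int_pow_int n)
  next
    case False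
    define k where "k = nat (- m)"
    have k: "m = - int k" using False by (simp add: k_def)
    have "inv\<^bsub>semidirect_int A \<psi>\<^esub> (\<one>, int k) = (\<one>, - int k)"
      by (rule S.inv_equality) (simp_all add: m o, simp_all add: semidirect_int_def)
    then show ?thesis by (simp only: k S.int_pow_neg[OF t] int_pow_int n)
  qed
qed

theorem semidirect_int_universal:
  assumes H: "group H" and f: "f \<in> hom A H" and s: "s \<in> carrier H"
    and rel: "\<And>a. a \<in> carrier A \<Longrightarrow> s \<otimes>\<^bsub>H\<^esub> f a \<otimes>\<^bsub>H\<^esub> inv\<^bsub>H\<^esub> s = f (\<psi> a)"
  shows "\<exists>!F. F \<in> hom (semidirect_int A \<psi>) H \<inter> extensional (carrier (semidirect_int A \<psi>))
           \<and> (\<forall>a\<in>carrier A. F (a, 0) = f a) \<and> F (\<one>, 1) = s"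
proof -
  interpret H: group H by (rule H)
  interpret S: group "semidirect_int A \<psi>" by (rule group_semidirect_int)
  have fc: "f a \<in> carrier H" if "a \<in> carrier A" for a
    using f that by (auto simp: hom_def)
  have fm: "f (a \<otimes> b) = f a \<otimes>\<^bsub>H\<^esub> f b" if "a \<in> carrier A" "b \<in> carrier A" for a b
    using f that by (auto simp: hom_def)
  have step: "s \<otimes>\<^bsub>H\<^esub> f a = f (\<psi> a) \<otimes>\<^bsub>H\<^esub> s" if a: "a \<in> carrier A" for a
    using H.inv_solve_right'[THEN iffD1, OF _ _ _ rel[OF a]] s fc[OF a]
      fc[OF auto_apply(1)[OF \<psi> a]] by simp
  have comm_nat: "s [^]\<^bsub>H\<^esub> (int k) \<otimes>\<^bsub>H\<^esub> f a = f (pw (int k) a) \<otimes>\<^bsub>H\<^esub> s [^]\<^bsub>H\<^esub> (int k)"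
    if a: "a \<in> carrier A" for k a
    using a
  proof (induction k arbitrary: a)
    case 0
    then show ?case using fc by simp
  next
    case (Suc k)
    have e: "s [^]\<^bsub>H\<^esub> (int (Suc k)) = s [^]\<^bsub>H\<^esub> (int k) \<otimes>\<^bsub>H\<^esub> s"
      using H.int_pow_mult[OF s, of "int k" 1] s by (simp add: H.int_pow_1 add.commute)
    have p: "pw (int (Suc k)) a = pw (int k) (\<psi> a)"
      using pw_add[OF Suc.prems, of "int k" 1] by (simp add: add.commute)
    have c: "\<psi> a \<in> carrier A" using auto_apply(1)[OF \<psi> Suc.prems] .
    have "s [^]\<^bsub>H\<^esub> (int (Suc k)) \<otimes>\<^bsub>H\<^esub> f a = s [^]\<^bsub>H\<^esub> (int k) \<otimes>\<^bsub>H\<^esub> (s \<otimes>\<^bsub>H\<^esub> f a)"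
      unfolding e using s fc Suc.prems by (intro H.m_assoc) auto
    also have "\<dots> = (s [^]\<^bsub>H\<^esub> (int k) \<otimes>\<^bsub>H\<^esub> f (\<psi> a)) \<otimes>\<^bsub>H\<^esub> s"
      unfolding step[OF Suc.prems] using s fc c by (intro H.m_assoc[symmetric]) auto
    also have "\<dots> = f (pw (int k) (\<psi> a)) \<otimes>\<^bsub>H\<^esub> (s [^]\<^bsub>H\<^esub> (int k) \<otimes>\<^bsub>H\<^esub> s)"
      unfolding Suc.IH[OF c] using s fc[OF pw_closed[OF c]] by (intro H.m_assoc) auto
    finally show ?case unfolding e p .
  qed
  have comm: "s [^]\<^bsub>H\<^esub> m \<otimes>\<^bsub>H\<^esub> f a = f (pw m a) \<otimes>\<^bsub>H\<^esub> s [^]\<^bsub>H\<^esub> m"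
    if a: "a \<in> carrier A" for m :: int and a
  proof (cases "m \<ge> 0")
    case True
    then show ?thesis using comm_nat[OF a, of "nat m"] by simp
  next
    case False
    define k where "k = nat (- m)"
    have m: "m = - int k" using False by (simp add: k_def)
    have c: "pw m a \<in> carrier A" using a by simp
    have "pw (int k) (pw m a) = a" using pw_add[OF a, of "int k" m] a by (simp add: m)
    then have e: "s [^]\<^bsub>H\<^esub> (int k) \<otimes>\<^bsub>H\<^esub> f (pw m a) = f a \<otimes>\<^bsub>H\<^esub> s [^]\<^bsub>H\<^esub> (int k)"
      using comm_nat[OF c, of k] by simp
    have i: "s [^]\<^bsub>H\<^esub> m = inv\<^bsub>H\<^esub> (s [^]\<^bsub>H\<^esub> (int k))"
      using s by (simp only: m H.int_pow_neg)
    let ?u = "s [^]\<^bsub>H\<^esub> (int k)"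
    have u: "?u \<in> carrier H" using s by (rule H.int_pow_closed)
    have "inv\<^bsub>H\<^esub> ?u \<otimes>\<^bsub>H\<^esub> f a = inv\<^bsub>H\<^esub> ?u \<otimes>\<^bsub>H\<^esub> ((f a \<otimes>\<^bsub>H\<^esub> ?u) \<otimes>\<^bsub>H\<^esub> inv\<^bsub>H\<^esub> ?u)"
      using u fc[OF a] by (simp add: H.m_assoc del: H.int_pow_closed)
    also have "\<dots> = inv\<^bsub>H\<^esub> ?u \<otimes>\<^bsub>H\<^esub> ((?u \<otimes>\<^bsub>H\<^esub> f (pw m a)) \<otimes>\<^bsub>H\<^esub> inv\<^bsub>H\<^esub> ?u)"
      unfolding e ..
    also have "\<dots> = (inv\<^bsub>H\<^esub> ?u \<otimes>\<^bsub>H\<^esub> ?u) \<otimes>\<^bsub>H\<^esub> (f (pw m a) \<otimes>\<^bsub>H\<^esub> inv\<^bsub>H\<^esub> ?u)"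
      using u fc[OF c] by (simp only: H.m_assoc H.m_closed H.inv_closed)
    also have "\<dots> = f (pw m a) \<otimes>\<^bsub>H\<^esub> inv\<^bsub>H\<^esub> ?u"
      using u fc[OF c] by (simp only: H.l_inv H.l_one H.m_closed H.inv_closed)
    finally show ?thesis unfolding i .
  qed
  define F where "F = (\<lambda>(a, m) \<in> carrier (semidirect_int A \<psi>). f a \<otimes>\<^bsub>H\<^esub> s [^]\<^bsub>H\<^esub> m)"
  have F: "F (a, m) = f a \<otimes>\<^bsub>H\<^esub> s [^]\<^bsub>H\<^esub> m" if "a \<in> carrier A" for a m
    using that by (simp add: F_def semidirect_int_def)
  have f1: "f \<one> = \<one>\<^bsub>H\<^esub>" using f by (rule hom_one[OF _ A H])
  show ?thesis
  proof (rule ex1I[of _ F])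
    have "F \<in> hom (semidirect_int A \<psi>) H"
    proof (rule homI)
      fix x assume "x \<in> carrier (semidirect_int A \<psi>)"
      then show "F x \<in> carrier H"
        using fc s by (auto simp: semidirect_int_def F)
    next
      fix x y
      assume "x \<in> carrier (semidirect_int A \<psi>)" "y \<in> carrier (semidirect_int A \<psi>)"
      then obtain a m b n where x: "x = (a, m)" "a \<in> carrier A" and y: "y = (b, n)" "b \<in> carrier A"
        by (auto simp: semidirect_int_def)
      have c: "f (pw m b) \<in> carrier H" "f a \<in> carrier H" "f b \<in> carrier H"
        "s [^]\<^bsub>H\<^esub> m \<in> carrier H" "s [^]\<^bsub>H\<^esub> n \<in> carrier H"
        using x y s fc by auto
      have "F (x \<otimes>\<^bsub>semidirect_int A \<psi>\<^esub> y) = F (a \<otimes> pw m b, m + n)"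
        using x y by (simp add: semidirect_int_def)
      also have "\<dots> = (f a \<otimes>\<^bsub>H\<^esub> f (pw m b)) \<otimes>\<^bsub>H\<^esub> (s [^]\<^bsub>H\<^esub> m \<otimes>\<^bsub>H\<^esub> s [^]\<^bsub>H\<^esub> n)"
        using x y s by (simp add: F fm H.int_pow_mult)
      also have "\<dots> = f a \<otimes>\<^bsub>H\<^esub> ((f (pw m b) \<otimes>\<^bsub>H\<^esub> s [^]\<^bsub>H\<^esub> m) \<otimes>\<^bsub>H\<^esub> s [^]\<^bsub>H\<^esub> n)"
        using c by (simp add: H.m_assoc)
      also have "\<dots> = f a \<otimes>\<^bsub>H\<^esub> ((s [^]\<^bsub>H\<^esub> m \<otimes>\<^bsub>H\<^esub> f b) \<otimes>\<^bsub>H\<^esub> s [^]\<^bsub>H\<^esub> n)"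
        using comm[OF y(2), of m] by simp
      also have "\<dots> = F x \<otimes>\<^bsub>H\<^esub> F y"
        using x y c by (simp add: F H.m_assoc)
      finally show "F (x \<otimes>\<^bsub>semidirect_int A \<psi>\<^esub> y) = F x \<otimes>\<^bsub>H\<^esub> F y" .
    qed
    moreover have "F \<in> extensional (carrier (semidirect_int A \<psi>))"
      by (simp add: F_def)
    moreover have "\<forall>a\<in>carrier A. F (a, 0) = f a"
      using fc by (simp add: F)
    moreover have "F (\<one>, 1) = s"
      using s by (simp add: F f1 H.int_pow_1)
    ultimately show "F \<in> hom (semidirect_int A \<psi>) H \<inter> extensional (carrier (semidirect_int A \<psi>))
        \<and> (\<forall>a\<in>carrier A. F (a, 0) = f a) \<and> F (\<one>, 1) = s" by simp
  next
    fix E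
    assume E: "E \<in> hom (semidirect_int A \<psi>) H \<inter> extensional (carrier (semidirect_int A \<psi>))
        \<and> (\<forall>a\<in>carrier A. E (a, 0) = f a) \<and> E (\<one>, 1) = s"
    then have Eh: "E \<in> hom (semidirect_int A \<psi>) H" by blast
    show "E = F"
    proof (rule extensionalityI[of _ "carrier (semidirect_int A \<psi>)"])
      show "E \<in> extensional (carrier (semidirect_int A \<psi>))" using E by blast
      show "F \<in> extensional (carrier (semidirect_int A \<psi>))" by (simp add: F_def)
      fix x assume "x \<in> carrier (semidirect_int A \<psi>)"
      then obtain a m where x: "x = (a, m)" "a \<in> carrier A"
        by (auto simp: semidirect_int_def)
      have t: "(\<one>, 1) \<in> carrier (semidirect_int A \<psi>)" by (simp add: semidirect_int_def)
      have ac: "(a, 0) \<in> carrier (semidirect_int A \<psi>)"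
        using x by (simp add: semidirect_int_def)
      have "x = (a, 0) \<otimes>\<^bsub>semidirect_int A \<psi>\<^esub> (\<one>, 1) [^]\<^bsub>semidirect_int A \<psi>\<^esub> m"
        unfolding semidirect_int_pow using x by (simp add: semidirect_int_def)
      then have "E x = E (a, 0) \<otimes>\<^bsub>H\<^esub> E ((\<one>, 1) [^]\<^bsub>semidirect_int A \<psi>\<^esub> m)"
        by (simp only: hom_mult[OF Eh ac S.int_pow_closed[OF t]])
      also have "E ((\<one>, 1) [^]\<^bsub>semidirect_int A \<psi>\<^esub> m) = s [^]\<^bsub>H\<^esub> m"
        using hom_int_pow[OF Eh t group_semidirect_int H, of m] E by argo
      also have "E (a, 0) = f a" using E x by blast
      finally show "E x = F x" unfolding x(1) F[OF x(2)] .
    qed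
  qed
qed

end

end

theory Submission
  imports Defs "Jordan_Normal_Form.Schur_Decomposition" "Jordan_Normal_Form.Jordan_Normal_Form_Existence"
begin

text \<open>
  If \<^verbatim>\<open>G_n\<close> is generated by two elements, Euclid's algorithm on their \<^verbatim>\<open>t\<close>-exponents turns one of them into a
  vector \<^verbatim>\<open>b\<close> whose orbit under \<^verbatim>\<open>A^n\<close> (where \<^verbatim>\<open>A\<close> is the given matrix) spans \<^verbatim>\<open>Z^d\<close>; by Cayley--Hamilton the
  determinant of the Krylov matrix \<^verbatim>\<open>[b, A^n b, ..., A^(n(d-1)) b]\<close> is then \<^verbatim>\<open>1\<close> or \<^verbatim>\<open>-1\<close>.
  This determinant is that of \<^verbatim>\<open>[b, A b, ..., A^(d-1) b]\<close> times the product over \<^verbatim>\<open>j < i\<close> of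
  \<^verbatim>\<open>(l_i^n - l_j^n) / (l_i - l_j)\<close>, where the \<^verbatim>\<open>l_i\<close> are the eigenvalues, so \<^verbatim>\<open>b\<close> can be chosen independently
  of \<^verbatim>\<open>n\<close>. Suppose this happens for infinitely many \<^verbatim>\<open>n\<close>. Some power of \<^verbatim>\<open>A\<close> is the identity modulo \<^verbatim>\<open>4\<close>, so
  Skolem's \<^verbatim>\<open>2\<close>-adic argument makes the determinant \<^verbatim>\<open>1\<close> or \<^verbatim>\<open>-1\<close> on a whole arithmetic progression. Along a
  subsequence of it the arguments of the eigenvalues are nearly constant, and there the product is unbounded
  unless the eigenvalues are distinct and all of modulus \<^verbatim>\<open>1\<close>. In that case the powers of \<^verbatim>\<open>A\<close> are
  bounded integer matrices, so \<^verbatim>\<open>A\<close> has finite order.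
\<close>

section \<open>Integer sequences with highly divisible differences\<close>

definition fwd_diff :: "(nat \<Rightarrow> int) \<Rightarrow> nat \<Rightarrow> int" where
  "fwd_diff f k = f (Suc k) - f k"

text \<open>
  An elementary substitute for \<^verbatim>\<open>q\<close>-adic analyticity: level \<^verbatim>\<open>0\<close> is a ring containing the entries of
  \<^verbatim>\<open>(1 + q B)^k\<close> as functions of \<^verbatim>\<open>k\<close>. Differencing a factor of a product raises its level by one,
  so the induction for products needs all levels \<^verbatim>\<open>a\<close>.
\<close>

definition diff_div :: "int \<Rightarrow> nat \<Rightarrow> (nat \<Rightarrow> int) \<Rightarrow> bool" where
  "diff_div q a f \<longleftrightarrow> (\<forall>i k. q ^ (i + a) dvd (fwd_diff ^^ i) f k)"

lemma fwd_diff_pow_Suc: "(fwd_diff ^^ Suc i) f = (fwd_diff ^^ i) (fwd_diff f)"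
  by (simp add: funpow_swap1)

lemma fwd_diff_pow_shift: "(fwd_diff ^^ i) (\<lambda>k. f (Suc k)) k = (fwd_diff ^^ i) f (Suc k)"
  by (induction i arbitrary: k) (simp_all add: fwd_diff_def)

lemma fwd_diff_pow_add:
  "(fwd_diff ^^ i) (\<lambda>k. f k + g k) k = (fwd_diff ^^ i) f k + (fwd_diff ^^ i) g k"
  by (induction i arbitrary: k) (simp_all add: fwd_diff_def)

lemma diff_div_add:
  "diff_div q a f \<Longrightarrow> diff_div q a g \<Longrightarrow> diff_div q a (\<lambda>k. f k + g k)"
  by (simp add: diff_div_def fwd_diff_pow_add)

lemma diff_div_shift: "diff_div q a f \<Longrightarrow> diff_div q a (\<lambda>k. f (Suc k))"
  by (simp add: diff_div_def fwd_diff_pow_shift)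

lemma diff_divD: "diff_div q a f \<Longrightarrow> q ^ (i + a) dvd (fwd_diff ^^ i) f k"
  by (simp add: diff_div_def)

lemma diff_div_fwd_diff: "diff_div q a f \<Longrightarrow> diff_div q (Suc a) (fwd_diff f)"
  using diff_divD[of q a f "Suc _"] by (simp add: diff_div_def fwd_diff_pow_Suc del: funpow.simps)

text \<open>Discrete Leibniz rule: the difference of f g is the difference of f times the shift of
  g, plus f times the difference of g. Both summands have total level a + b + 1, so the induction
  hypothesis applies to them at raised levels.\<close>

lemma diff_div_mult:
  assumes "diff_div q a f" "diff_div q b g"
  shows "diff_div q (a + b) (\<lambda>k. f k * g k)"
proof -
  have "q ^ (i + (a + b)) dvd (fwd_diff ^^ i) (\<lambda>k. f k * g k) k" for i k
    using assms
  proof (induction i arbitrary: a b f g k)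
    case 0
    have "q ^ a dvd f k" "q ^ b dvd g k"
      using diff_divD[OF 0(1), of 0 k] diff_divD[OF 0(2), of 0 k] by simp_all
    then show ?case by (simp add: power_add mult_dvd_mono)
  next
    case (Suc i)
    have "fwd_diff (\<lambda>k. f k * g k) = (\<lambda>k. fwd_diff f k * g (Suc k) + f k * fwd_diff g k)"
      by (rule ext) (simp add: fwd_diff_def algebra_simps)
    then have "(fwd_diff ^^ Suc i) (\<lambda>k. f k * g k) k
        = (fwd_diff ^^ i) (\<lambda>k. fwd_diff f k * g (Suc k)) k + (fwd_diff ^^ i) (\<lambda>k. f k * fwd_diff g k) k"
      by (simp only: fwd_diff_pow_Suc fwd_diff_pow_add)
    moreover have "q ^ (Suc i + (a + b)) dvd (fwd_diff ^^ i) (\<lambda>k. fwd_diff f k * g (Suc k)) k"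
      using Suc.IH[OF diff_div_fwd_diff[OF Suc.prems(1)] diff_div_shift[OF Suc.prems(2)], of k] by simp
    moreover have "q ^ (Suc i + (a + b)) dvd (fwd_diff ^^ i) (\<lambda>k. f k * fwd_diff g k) k"
      using Suc.IH[OF Suc.prems(1) diff_div_fwd_diff[OF Suc.prems(2)], of k] by simp
    ultimately show ?case by simp
  qed
  then show ?thesis by (simp add: diff_div_def)
qed

lemma diff_div_const: "diff_div q 0 (\<lambda>_. c)"
proof -
  have "(fwd_diff ^^ Suc i) (\<lambda>_. c) k = 0" for i k
    by (induction i arbitrary: k) (simp_all add: fwd_diff_def)
  then have "q ^ i dvd (fwd_diff ^^ i) (\<lambda>_. c) k" for i k
    by (cases i) simp_all
  then show ?thesis by (simp add: diff_div_def)
qed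

lemma diff_div_sum:
  "finite A \<Longrightarrow> (\<And>x. x \<in> A \<Longrightarrow> diff_div q 0 (f x)) \<Longrightarrow> diff_div q 0 (\<lambda>k. \<Sum>x\<in>A. f x k)"
  by (induction rule: finite_induct) (simp_all add: diff_div_const diff_div_add)

lemma diff_div_prod:
  "finite A \<Longrightarrow> (\<And>x. x \<in> A \<Longrightarrow> diff_div q 0 (f x)) \<Longrightarrow> diff_div q 0 (\<lambda>k. \<Prod>x\<in>A. f x k)"
  by (induction rule: finite_induct) (use diff_div_mult[of q 0 _ 0] in \<open>simp_all add: diff_div_const\<close>)

section \<open>Newton series and the 2-adic size of factorials\<close>

text \<open>Gregory-Newton interpolation, by Pascal's rule. The sum runs to \<open>M\<close> instead
  of \<open>k\<close>, so that one truncated series represents \<open>f\<close> at all points up to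
  \<open>M\<close>.\<close>

lemma newton_forward:
  "k \<le> M \<Longrightarrow> f k = (\<Sum>m\<le>M. int (k choose m) * (fwd_diff ^^ m) f 0)"
proof (induction k arbitrary: f)
  case 0
  have "(\<Sum>m\<le>M. int (0 choose m) * (fwd_diff ^^ m) f 0) = (\<Sum>m\<in>{0}. int (0 choose m) * (fwd_diff ^^ m) f 0)"
    by (rule sum.mono_neutral_right) auto
  then show ?case by simp
next
  case (Suc k)
  define L where "L = M - 1"
  have M: "M = Suc L" and k: "k \<le> L" using Suc.prems by (auto simp: L_def)
  let ?a = "\<lambda>m. (fwd_diff ^^ m) f 0"
  have "f (Suc k) = f k + fwd_diff f k" by (simp add: fwd_diff_def)
  also have "f k = (\<Sum>m\<le>M. int (k choose m) * ?a m)"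
    using Suc.IH[of f] k M by simp
  also have "\<dots> = ?a 0 + (\<Sum>m\<le>L. int (k choose Suc m) * ?a (Suc m))"
    unfolding M by (subst sum.atMost_Suc_shift) simp
  also have "fwd_diff f k = (\<Sum>m\<le>M. int (k choose m) * ?a (Suc m))"
    unfolding fwd_diff_pow_Suc using Suc.IH[of "fwd_diff f"] k M by simp
  \<comment> \<open>The term \<open>m = M\<close> vanishes because \<open>k < M\<close>.\<close>
  also have "\<dots> = (\<Sum>m\<le>L. int (k choose m) * ?a (Suc m))"
    using k by (simp add: M binomial_eq_0)
  finally have "f (Suc k) = ?a 0 + (\<Sum>m\<le>L. int (Suc k choose Suc m) * ?a (Suc m))"
    by (simp add: algebra_simps sum.distrib)
  also have "\<dots> = (\<Sum>m\<le>M. int (Suc k choose m) * ?a m)"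
    unfolding M by (subst sum.atMost_Suc_shift) simp
  finally show ?case .
qed

text \<open>The even factors of (2h)! contribute 2^h h!; \<open>u\<close> is the product of the odd
  numbers below 2h.\<close>

lemma fact_double: "\<exists>u::nat. odd u \<and> fact (2 * h) = 2 ^ h * fact h * u"
proof (induction h)
  case 0
  then show ?case by (intro exI[of _ 1]) simp
next
  case (Suc h)
  then obtain u :: nat where u: "odd u" "fact (2 * h) = 2 ^ h * fact h * u" by blast
  have "fact (2 * Suc h) = (2 * h + 2) * ((2 * h + 1) * (fact (2 * h) :: nat))"
    by (simp add: algebra_simps)
  also have "\<dots> = 2 ^ Suc h * fact (Suc h) * ((2 * h + 1) * u)"
    unfolding u(2) by (simp add: algebra_simps)
  finally have "fact (2 * Suc h) = 2 ^ Suc h * fact (Suc h) * ((2 * h + 1) * u)" .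
  then show ?case using u(1) by (intro exI[of _ "(2 * h + 1) * u"]) simp
qed

text \<open>A weak form of Legendre's formula: the exponent of 2 in m! is at most m. The strong
  induction halves \<open>m\<close> through \<open>fact_double\<close>.\<close>

lemma fact_dvd_odd_mult_power2: "\<exists>u::nat. odd u \<and> fact m dvd u * 2 ^ m"
proof (induction m rule: less_induct)
  case (less m)
  show ?case
  proof (cases "m = 0")
    case True
    then show ?thesis by (intro exI[of _ 1]) simp
  next
    case False
    define h where "h = m div 2"
    obtain u v :: nat where u: "odd u" "fact h dvd u * 2 ^ h"
      and v: "odd v" "fact (2 * h) = 2 ^ h * fact h * v"
      using less[of h] False fact_double[of h] by (auto simp: h_def)
    have d: "fact (2 * h) dvd (u * v) * 2 ^ (2 * h)"
    proof -
      have "(2 ^ h * fact h) * v dvd (2 ^ h * (u * 2 ^ h)) * v"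
        by (intro mult_dvd_mono dvd_refl u(2))
      also have "\<dots> = (u * v) * 2 ^ (2 * h)"
        by (simp add: mult_2 power_add)
      finally show ?thesis unfolding v(2) .
    qed
    show ?thesis
    proof (cases "even m")
      case True
      then show ?thesis using d u v by (intro exI[of _ "u * v"]) (simp add: h_def)
    next
      case odd: False
      then have m: "m = Suc (2 * h)" by (simp add: h_def)
      \<comment> \<open>The odd number \<open>m\<close> joins the multiplier; the surplus factor 2
        only brings the exponent to \<open>m = 2 * h + 1\<close>.\<close>
      have "m * fact (2 * h) dvd m * ((u * v) * 2 ^ (2 * h) * 2)"
        by (intro mult_dvd_mono dvd_refl dvd_mult2 d)
      moreover have "m * fact (2 * h) = (fact m :: nat)" by (simp add: m)
      moreover have "m * ((u * v) * 2 ^ (2 * h) * 2) = m * (u * v) * 2 ^ m"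
        by (simp only: m power_Suc mult_ac)
      ultimately have "fact m dvd m * (u * v) * 2 ^ m" by simp
      then show ?thesis using odd u v by (intro exI[of _ "m * (u * v)"]) simp
    qed
  qed
qed

text \<open>A single odd multiplier has to clear the odd parts of all denominators m! of a truncated
  Newton series.\<close>

lemma common_odd_denominator: "\<exists>u::nat. odd u \<and> (\<forall>m\<le>M. fact m dvd u * 2 ^ m)"
proof (induction M)
  case 0
  then show ?case by (intro exI[of _ 1]) simp
next
  case (Suc M)
  then obtain u :: nat where u: "odd u" "\<forall>m\<le>M. fact m dvd u * 2 ^ m" by blast
  obtain v :: nat where v: "odd v" "fact (Suc M) dvd v * 2 ^ Suc M"
    using fact_dvd_odd_mult_power2 by blast
  have "fact m dvd (u * v) * 2 ^ m" if "m \<le> Suc M" for m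
  proof (cases "m \<le> M")
    case True
    then have "fact m dvd (u * 2 ^ m) * v" using u by (simp add: dvd_mult2)
    then show ?thesis by (simp only: mult_ac)
  next
    case False
    then have "m = Suc M" using that by simp
    then have "fact m dvd (v * 2 ^ m) * u" using v by (simp add: dvd_mult2)
    then show ?thesis by (simp only: mult_ac)
  qed
  then show ?case using u v by (intro exI[of _ "u * v"]) simp
qed

text \<open>The falling factorial X (X - 1) ... (X - m + 1), that is, m! times the binomial
  polynomial, with integer coefficients.\<close>

definition falling_poly :: "nat \<Rightarrow> int poly" where
  "falling_poly m = (\<Prod>i<m. [:- int i, 1:])"

lemma poly_falling_poly: "poly (falling_poly m) (int k) = fact m * int (k choose m)"
proof (induction m)
  case 0
  then show ?case by (simp add: falling_poly_def)
next
  case (Suc m)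
  have "(k choose m) * (k - m) = Suc m * (k choose Suc m)"
    using binomial_absorb_comp[of k m] binomial_absorption[of m k] by (simp add: mult.commute)
  then have *: "int (k choose m) * (int k - int m) = int (Suc m) * int (k choose Suc m)"
  proof (cases "m \<le> k")
    case True
    then show ?thesis using arg_cong[OF \<open>(k choose m) * (k - m) = _\<close>, of int]
      by (simp only: of_nat_diff of_nat_mult)
  qed (simp add: binomial_eq_0)
  have "poly (falling_poly (Suc m)) (int k) = poly (falling_poly m) (int k) * (int k - int m)"
    by (simp add: falling_poly_def poly_prod algebra_simps)
  also have "\<dots> = fact m * (int (k choose m) * (int k - int m))"
    by (simp only: Suc mult.assoc)
  also have "\<dots> = fact (Suc m) * int (k choose Suc m)"
    by (simp only: * fact_Suc mult_ac of_nat_mult)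
  finally show ?case .
qed

lemma coeff_falling_poly_eq_0: "j > m \<Longrightarrow> coeff (falling_poly m) j = 0"
proof -
  have "degree (falling_poly m) \<le> m"
    unfolding falling_poly_def
    by (rule order_trans[OF degree_prod_sum_le]) auto
  then show "j > m \<Longrightarrow> ?thesis" by (intro coeff_eq_0) simp
qed

section \<open>Integer polynomials with 2-adically decaying coefficients\<close>

text \<open>Equivalently, \<open>p\<close> is 2^e r(2X) for an integer polynomial r.\<close>

definition coeff_div :: "nat \<Rightarrow> int poly \<Rightarrow> bool" where
  "coeff_div e p \<longleftrightarrow> (\<forall>j. 2 ^ (j + e) dvd coeff p j)"

text \<open>Horner's recursion for the quotient, followed downwards from its degree: coefficient j
  of \<open>q\<close> involves coefficient j + 1 of \<open>p\<close>, and this index shift supplies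
  the extra factor 2.\<close>

lemma coeff_div_synthetic_div:
  assumes p: "coeff_div e p" and z: "poly p z = 0"
  obtains q where "p = [:- z, 1:] * q" "coeff_div (Suc e) q"
proof -
  obtain q where q: "p = [:- z, 1:] * q" using z unfolding poly_eq_0_iff_dvd by blast
  have c: "coeff q j = coeff p (Suc j) + z * coeff q (Suc j)" for j
    by (simp add: q)
  have "2 ^ (j + Suc e) dvd coeff q j" for j
  proof (cases "j > degree q")
    case True
    then show ?thesis by (simp add: coeff_eq_0)
  next
    case False
    then show ?thesis
    proof (induction "Suc (degree q) - j" arbitrary: j)
      case (Suc n)
      have "2 ^ (Suc j + Suc e) dvd coeff q (Suc j)"
      proof (cases "Suc j > degree q")
        case False
        then show ?thesis using Suc by (intro Suc) auto
      qed (simp add: coeff_eq_0)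
      then have "2 ^ (j + Suc e) dvd coeff q (Suc j)" by (rule power_le_dvd) simp
      moreover have "2 ^ (j + Suc e) dvd coeff p (Suc j)"
        using p[unfolded coeff_div_def, rule_format, of "Suc j"] by simp
      ultimately show ?case by (simp add: c[of j])
    qed simp
  qed
  then have "coeff_div (Suc e) q" unfolding coeff_div_def by blast
  with q show thesis by (rule that)
qed

text \<open>Dividing out the roots one by one raises the level from \<open>e\<close> to
  \<open>e + card Z\<close>, and 2 to the level divides every value of the last quotient.\<close>

lemma coeff_div_many_roots:
  assumes "finite Z" "coeff_div e p" "\<And>z. z \<in> Z \<Longrightarrow> poly p z = 0"
  shows "2 ^ (e + card Z) dvd poly p x"
  using assms
proof (induction Z arbitrary: e p rule: finite_induct)
  case empty
  have "2 ^ e dvd coeff p j" for j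
    using empty(1) unfolding coeff_div_def by (meson le_add2 power_le_dvd)
  then show ?case by (auto simp: poly_altdef intro!: dvd_sum)
next
  case (insert z Z)
  obtain q where q: "p = [:- z, 1:] * q" "coeff_div (Suc e) q"
    using coeff_div_synthetic_div[OF insert(4), of z] insert(5) by blast
  have "poly q y = 0" if "y \<in> Z" for y
    using insert(5)[of y] insert(2) that by (auto simp: q)
  then have "2 ^ (Suc e + card Z) dvd poly q x"
    using insert(3) q(2) by blast
  then show ?case using insert(1,2) by (simp add: q(1))
qed

text \<open>
  Strassmann's theorem without \<^verbatim>\<open>2\<close>-adic numbers: up to an odd factor \<^verbatim>\<open>u\<close>, the truncated Newton series
  is an integer polynomial that agrees with \<^verbatim>\<open>u f\<close> at all points in question and whose \<^verbatim>\<open>j\<close>-th coefficient is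
  divisible by \<^verbatim>\<open>2^j\<close>; each zero that is split off gains a factor \<^verbatim>\<open>2\<close>.
\<close>

theorem diff_div_infinite_zeros:
  assumes f: "diff_div 4 0 f" and inf: "infinite {k. f k = 0}"
  shows "f n = 0"
proof -
  have "2 ^ s dvd f n" for s
  proof -
    obtain Z where Z: "Z \<subseteq> {k. f k = 0}" "finite Z" "card Z = s"
      using infinite_arbitrarily_large[OF inf] by blast
    define M where "M = Max (insert n Z)"
    have M: "k \<le> M" if "k \<in> insert n Z" for k
      using Z that by (simp add: M_def)
    obtain u :: nat where u: "odd u" "\<And>m. m \<le> M \<Longrightarrow> fact m dvd u * 2 ^ m"
      using common_odd_denominator[of M] by blast
    \<comment> \<open>The Newton coefficient is divisible by 4^m = 2^m 2^m. One factor 2^m, together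
      with \<open>u\<close>, absorbs m!; the other one remains as the required divisibility.\<close>
    have "\<exists>c. c * fact m = int u * (fwd_diff ^^ m) f 0 \<and> 2 ^ m dvd c" if m: "m \<le> M" for m
    proof -
      obtain a where a: "(fwd_diff ^^ m) f 0 = 4 ^ m * a"
        using diff_divD[OF f, of m 0] by (auto elim: dvdE)
      obtain b where b: "u * 2 ^ m = fact m * b" using u(2)[OF m] by (metis dvdE)
      have b': "int u * 2 ^ m = fact m * int b"
        using arg_cong[OF b, of int] by (simp only: of_nat_mult of_nat_power of_nat_fact of_nat_numeral)
      have "int u * (fwd_diff ^^ m) f 0 = (int u * 2 ^ m) * 2 ^ m * a"
        by (simp add: a mult_ac flip: power_mult_distrib)
      then have "(2 ^ m * int b * a) * fact m = int u * (fwd_diff ^^ m) f 0"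
        unfolding b' by (simp add: mult_ac)
      then show ?thesis by (intro exI[of _ "2 ^ m * int b * a"]) simp
    qed
    then obtain c where c: "\<And>m. m \<le> M \<Longrightarrow> c m * fact m = int u * (fwd_diff ^^ m) f 0"
      "\<And>m. m \<le> M \<Longrightarrow> 2 ^ m dvd c m" by metis
    define p where "p = (\<Sum>m\<le>M. smult (c m) (falling_poly m))"
    have p: "poly p (int k) = int u * f k" if "k \<le> M" for k
    proof -
      have "poly p (int k) = (\<Sum>m\<le>M. (c m * fact m) * int (k choose m))"
        by (simp add: p_def poly_sum poly_falling_poly mult_ac)
      also have "\<dots> = int u * (\<Sum>m\<le>M. int (k choose m) * (fwd_diff ^^ m) f 0)"
        unfolding sum_distrib_left by (rule sum.cong) (simp_all add: c)
      finally show ?thesis using newton_forward[OF that, of f] by simp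
    qed
    have "2 ^ j dvd coeff p j" for j
      unfolding p_def coeff_sum
    proof (rule dvd_sum)
      fix m assume m: "m \<in> {..M}"
      show "2 ^ j dvd coeff (smult (c m) (falling_poly m)) j"
      proof (cases "m < j")
        case False
        then have "2 ^ j dvd c m" using c(2)[of m] m by (meson atMost_iff not_less power_le_dvd)
        then show ?thesis by simp
      qed (simp add: coeff_falling_poly_eq_0)
    qed
    then have "coeff_div 0 p" by (simp add: coeff_div_def)
    moreover have "poly p z = 0" if z: "z \<in> int ` Z" for z
    proof -
      obtain k where k: "z = int k" "k \<in> Z" using z by blast
      then show ?thesis using p[of k] M[of k] Z(1) by auto
    qed
    ultimately have "2 ^ (0 + card (int ` Z)) dvd poly p (int n)"
      using Z(2) by (intro coeff_div_many_roots) auto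
    then have "2 ^ s dvd int u * f n"
      using p[of n] M Z by (simp add: card_image inj_on_def)
    moreover have "coprime (2 ^ s) (int u)" using u(1) by simp
    ultimately show ?thesis by (simp add: coprime_dvd_mult_right_iff)
  qed
  \<comment> \<open>Taking \<open>s\<close> to be the absolute value of \<open>f n\<close> suffices:
    a nonzero integer x is smaller in modulus than 2^|x|.\<close>
  then have "2 ^ nat (\<bar>f n\<bar>) dvd f n" .
  show ?thesis
  proof (rule ccontr)
    assume "f n \<noteq> 0"
    then have "2 ^ nat \<bar>f n\<bar> \<le> \<bar>f n\<bar>"
      using \<open>2 ^ nat (\<bar>f n\<bar>) dvd f n\<close> zdvd_imp_le[of "2 ^ nat \<bar>f n\<bar>" "\<bar>f n\<bar>"] by simp
    moreover have "int (nat \<bar>f n\<bar>) < 2 ^ nat \<bar>f n\<bar>" by (rule of_nat_less_two_power)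
    ultimately show False by simp
  qed
qed

section \<open>Krylov matrices of powers\<close>

lemma mult_mat_vec_index_sum:
  "A \<in> carrier_mat d d \<Longrightarrow> v \<in> carrier_vec d \<Longrightarrow> i < d \<Longrightarrow> (A *\<^sub>v v) $ i = (\<Sum>c<d. A $$ (i, c) * v $ c)"
  by (simp add: scalar_prod_def lessThan_atLeast0)

lemma mult_mat_index_sum:
  "A \<in> carrier_mat d d \<Longrightarrow> B \<in> carrier_mat d d \<Longrightarrow> i < d \<Longrightarrow> j < d \<Longrightarrow>
    (A * B) $$ (i, j) = (\<Sum>c<d. A $$ (i, c) * B $$ (c, j))"
  by (simp add: scalar_prod_def lessThan_atLeast0)

lemma pow_mat_add:
  assumes "A \<in> carrier_mat d d"
  shows "A ^\<^sub>m (m + n) = A ^\<^sub>m m * A ^\<^sub>m n"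
proof (induction n)
  case (Suc n)
  then show ?case using assms by (simp add: assoc_mult_mat[of _ d d _ d _ d])
qed (use assms in simp)

lemma pow_mat_mult:
  assumes "A \<in> carrier_mat d d"
  shows "(A ^\<^sub>m m) ^\<^sub>m n = A ^\<^sub>m (m * n)"
  by (induction n) (use assms in \<open>simp_all add: pow_mat_add[OF assms, symmetric] add.commute\<close>)

lemma pow_mat_Suc_left:
  "A \<in> carrier_mat d d \<Longrightarrow> A ^\<^sub>m Suc k = A * A ^\<^sub>m k"
  using pow_mat_add[of A d 1 k] by simp

section \<open>Krylov determinants in the Newton basis\<close>

definition krylov :: "nat \<Rightarrow> 'a :: comm_ring_1 mat \<Rightarrow> 'a vec \<Rightarrow> 'a mat" where
  "krylov d A b = mat d d (\<lambda>(i, j). (A ^\<^sub>m j *\<^sub>v b) $ i)"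

lemma krylov_carrier [simp]: "krylov d A b \<in> carrier_mat d d"
  by (simp add: krylov_def)

text \<open>The vector (A - l_(j-1)) ... (A - l_0) b. If the l_i are the diagonal entries of a lower
  triangular \<open>A\<close>, it begins with j zeros, unlike A^j b.\<close>

primrec newton_vec :: "(nat \<Rightarrow> 'a) \<Rightarrow> 'a :: comm_ring_1 mat \<Rightarrow> 'a vec \<Rightarrow> nat \<Rightarrow> 'a vec" where
  "newton_vec l A b 0 = b"
| "newton_vec l A b (Suc j) = A *\<^sub>v newton_vec l A b j - l j \<cdot>\<^sub>v newton_vec l A b j"

definition newton_poly :: "(nat \<Rightarrow> 'a) \<Rightarrow> nat \<Rightarrow> 'a :: comm_ring_1 poly" where
  "newton_poly l j = (\<Prod>i<j. [:- l i, 1:])"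

lemma newton_vec_carrier [simp]:
  "A \<in> carrier_mat d d \<Longrightarrow> b \<in> carrier_vec d \<Longrightarrow> newton_vec l A b j \<in> carrier_vec d"
  by (induction j) auto

lemma newton_poly_Suc: "newton_poly l (Suc j) = newton_poly l j * [:- l j, 1:]"
  by (simp add: newton_poly_def)

lemma coeff_newton_poly_Suc:
  "coeff (newton_poly l (Suc j)) i =
    (case i of 0 \<Rightarrow> 0 | Suc i' \<Rightarrow> coeff (newton_poly l j) i') - l j * coeff (newton_poly l j) i"
  by (simp add: newton_poly_Suc coeff_pCons split: nat.split)

lemma coeff_newton_poly:
  "coeff (newton_poly l j) j = 1" "i > j \<Longrightarrow> coeff (newton_poly l j) i = 0"
proof -
  have "coeff (newton_poly l j) j = 1 \<and> (\<forall>i>j. coeff (newton_poly l j) i = 0)"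
  proof (induction j)
    case 0
    then show ?case by (simp add: newton_poly_def coeff_pCons split: nat.split)
  next
    case (Suc j)
    then show ?case by (auto simp: coeff_newton_poly_Suc split: nat.split)
  qed
  then show "coeff (newton_poly l j) j = 1" "i > j \<Longrightarrow> coeff (newton_poly l j) i = 0"
    by auto
qed

text \<open>\<open>newton_vec l A b j\<close> is \<open>newton_poly l j\<close> evaluated at
  \<open>A\<close> and applied to \<open>b\<close>. The coordinate form avoids evaluating
  polynomials at matrices; multiplication by \<open>A\<close> shifts the coefficients.\<close>

lemma newton_vec_index:
  assumes A: "A \<in> carrier_mat d d" and b: "b \<in> carrier_vec d"
  shows "a < d \<Longrightarrow> newton_vec l A b j $ a = (\<Sum>i\<le>j. coeff (newton_poly l j) i * (A ^\<^sub>m i *\<^sub>v b) $ a)"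
proof (induction j arbitrary: a)
  case 0
  then show ?case using A b by (simp add: newton_poly_def)
next
  case (Suc j)
  let ?p = "newton_poly l j" and ?x = "\<lambda>i. A ^\<^sub>m i *\<^sub>v b"
  note [simp del] = pow_mat.simps
  have x: "?x i \<in> carrier_vec d" for i
    using A b by (intro mult_mat_vec_carrier[of _ d d]) auto
  have "(A *\<^sub>v newton_vec l A b j) $ a = (\<Sum>c<d. A $$ (a, c) * (\<Sum>i\<le>j. coeff ?p i * ?x i $ c))"
    unfolding mult_mat_vec_index_sum[OF A newton_vec_carrier[OF A b] Suc.prems]
    using Suc.IH by (simp del: index_mult_mat_vec)
  also have "\<dots> = (\<Sum>c<d. \<Sum>i\<le>j. coeff ?p i * (A $$ (a, c) * ?x i $ c))"
    by (simp only: sum_distrib_left mult_ac)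
  also have "\<dots> = (\<Sum>i\<le>j. \<Sum>c<d. coeff ?p i * (A $$ (a, c) * ?x i $ c))"
    by (rule sum.swap)
  also have "\<dots> = (\<Sum>i\<le>j. coeff ?p i * (A *\<^sub>v ?x i) $ a)"
    using mult_mat_vec_index_sum[OF A x Suc.prems] by (simp only: sum_distrib_left[symmetric])
  also have "\<dots> = (\<Sum>i\<le>j. coeff ?p i * ?x (Suc i) $ a)"
    using A b by (simp add: pow_mat_Suc_left[OF A] assoc_mult_mat_vec[of _ d d _ d])
  also have "\<dots> = (\<Sum>i\<le>Suc j. (case i of 0 \<Rightarrow> 0 | Suc i' \<Rightarrow> coeff ?p i') * ?x i $ a)"
    by (simp only: sum.atMost_Suc_shift) simp
  finally have 1: "(A *\<^sub>v newton_vec l A b j) $ a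
    = (\<Sum>i\<le>Suc j. (case i of 0 \<Rightarrow> 0 | Suc i' \<Rightarrow> coeff ?p i') * ?x i $ a)" .
  have 2: "newton_vec l A b j $ a = (\<Sum>i\<le>Suc j. coeff ?p i * ?x i $ a)"
    using Suc by (simp add: coeff_newton_poly)
  have "newton_vec l A b (Suc j) $ a = (A *\<^sub>v newton_vec l A b j) $ a - l j * newton_vec l A b j $ a"
    using A Suc.prems carrier_vecD[OF newton_vec_carrier[OF A b, of l j]] by (simp del: index_mult_mat_vec)
  then show ?case
    unfolding 1 2 by (simp only: coeff_newton_poly_Suc sum_distrib_left sum_subtractf[symmetric] left_diff_distrib mult.assoc)
qed

text \<open>\<open>newton_poly l j\<close> is monic of degree j, so the column change
  \<open>C\<close> is upper triangular with ones on the diagonal.\<close>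

lemma det_newton_vec_eq_krylov:
  fixes A :: "'a :: comm_ring_1 mat"
  assumes A: "A \<in> carrier_mat d d" and b: "b \<in> carrier_vec d"
  shows "det (mat d d (\<lambda>(i, j). newton_vec l A b j $ i)) = det (krylov d A b)"
proof -
  define C where "C = mat d d (\<lambda>(i, j). coeff (newton_poly l j) i)"
  have C: "C \<in> carrier_mat d d" by (simp add: C_def)
  have "mat d d (\<lambda>(i, j). newton_vec l A b j $ i) = krylov d A b * C"
  proof (rule eq_matI)
    fix i j assume "i < dim_row (krylov d A b * C)" "j < dim_col (krylov d A b * C)"
    then have ij: "i < d" "j < d" by (simp_all add: C_def krylov_def)
    have "newton_vec l A b j $ i = (\<Sum>c\<le>j. coeff (newton_poly l j) c * (A ^\<^sub>m c *\<^sub>v b) $ i)"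
      by (rule newton_vec_index[OF A b ij(1)])
    also have "\<dots> = (\<Sum>c<d. coeff (newton_poly l j) c * (A ^\<^sub>m c *\<^sub>v b) $ i)"
      by (rule sum.mono_neutral_left) (use ij in \<open>auto simp: coeff_newton_poly\<close>)
    also have "\<dots> = (krylov d A b * C) $$ (i, j)"
      unfolding mult_mat_index_sum[OF krylov_carrier C ij]
      using ij by (simp add: krylov_def C_def mult.commute del: index_mult_mat_vec)
    finally show "mat d d (\<lambda>(i, j). newton_vec l A b j $ i) $$ (i, j) = (krylov d A b * C) $$ (i, j)"
      using ij by simp
  qed (simp_all add: C_def krylov_def)
  moreover have "det C = 1"
  proof -
    have "upper_triangular C" by (rule upper_triangularI) (simp add: C_def coeff_newton_poly)
    then have "det C = prod_list (diag_mat C)" by (rule det_upper_triangular[OF _ C])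
    also have "diag_mat C = replicate d 1"
      by (rule nth_equalityI) (simp_all add: diag_mat_def C_def coeff_newton_poly)
    finally show ?thesis by simp
  qed
  ultimately show ?thesis by (simp add: det_mult[OF krylov_carrier C])
qed

section \<open>Powers of lower triangular matrices\<close>

definition lower_tri :: "nat \<Rightarrow> 'a :: comm_ring_1 mat \<Rightarrow> bool" where
  "lower_tri d A \<longleftrightarrow> A \<in> carrier_mat d d \<and> (\<forall>i<d. \<forall>j<d. i < j \<longrightarrow> A $$ (i, j) = 0)"

lemma lower_tri_carrier: "lower_tri d A \<Longrightarrow> A \<in> carrier_mat d d"
  by (simp add: lower_tri_def)

text \<open>Coordinates of \<open>v\<close> before i vanish, as do entries of row i to the right of
  the diagonal, so a single product survives. The determinants below are read off from diagonals in
  this way.\<close>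

lemma lower_tri_mult_vec_index:
  assumes A: "lower_tri d A" and v: "v \<in> carrier_vec d" "\<And>c. c < i \<Longrightarrow> v $ c = 0"
  shows "a < i \<Longrightarrow> a < d \<Longrightarrow> (A *\<^sub>v v) $ a = 0"
    and "i < d \<Longrightarrow> (A *\<^sub>v v) $ i = A $$ (i, i) * v $ i"
proof -
  note * = mult_mat_vec_index_sum[OF lower_tri_carrier[OF A] v(1)]
  show "(A *\<^sub>v v) $ a = 0" if "a < i" "a < d"
    unfolding *[OF that(2)]
  proof (rule sum.neutral, rule ballI)
    fix c assume c: "c \<in> {..<d}"
    show "A $$ (a, c) * v $ c = 0"
    proof (cases "c < i")
      case False
      then show ?thesis using A that c by (simp add: lower_tri_def)
    qed (simp add: v(2))
  qed
  show "(A *\<^sub>v v) $ i = A $$ (i, i) * v $ i" if i: "i < d"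
  proof -
    have "(\<Sum>c<d. A $$ (i, c) * v $ c) = (\<Sum>c\<in>{i}. A $$ (i, c) * v $ c)"
    proof (rule sum.mono_neutral_right)
      show "\<forall>c\<in>{..<d} - {i}. A $$ (i, c) * v $ c = 0"
      proof
        fix c assume c: "c \<in> {..<d} - {i}"
        then consider "c < i" | "i < c" by fastforce
        then show "A $$ (i, c) * v $ c = 0"
          by cases (use A i c v(2) in \<open>simp_all add: lower_tri_def\<close>)
      qed
    qed (use i in auto)
    then show ?thesis by (simp add: *[OF i])
  qed
qed

lemma lower_tri_mult:
  assumes A: "lower_tri d A" and B: "lower_tri d B"
  shows "lower_tri d (A * B)" and "i < d \<Longrightarrow> (A * B) $$ (i, i) = A $$ (i, i) * B $$ (i, i)"
proof -
  note c = lower_tri_carrier[OF A] lower_tri_carrier[OF B]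
  have col: "(A * B) $$ (i, j) = (A *\<^sub>v col B j) $ i" if "i < d" "j < d" for i j
    using that c by simp
  have z: "k < j \<Longrightarrow> col B j $ k = 0" if "j < d" for j k
    using that B c by (simp add: lower_tri_def)
  have "(A * B) $$ (i, j) = 0" if "i < d" "j < d" "i < j" for i j
    using lower_tri_mult_vec_index(1)[OF A, of "col B j" j i] z[of j] col[of i j] that c
    by (simp del: index_mult_mat_vec index_mult_mat(1))
  then show "lower_tri d (A * B)" using c by (simp add: lower_tri_def)
  show "(A * B) $$ (i, i) = A $$ (i, i) * B $$ (i, i)" if "i < d"
    using lower_tri_mult_vec_index(2)[OF A, of "col B i" i] z[of i] col[of i i] that c
    by (simp del: index_mult_mat_vec index_mult_mat(1))
qed

lemma lower_tri_one: "lower_tri d (1\<^sub>m d)"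
  by (simp add: lower_tri_def)

lemma lower_tri_pow:
  assumes A: "lower_tri d A"
  shows "lower_tri d (A ^\<^sub>m n) \<and> (\<forall>i<d. (A ^\<^sub>m n) $$ (i, i) = A $$ (i, i) ^ n)"
  using A lower_tri_carrier[OF A]
  by (induction n) (auto simp: lower_tri_one mult.commute lower_tri_mult simp del: index_mult_mat)

text \<open>The factor A - l_j kills coordinate j of a vector that begins with j zeros, so every
  factor adds a zero. At \<open>j = d\<close> the whole vector is zero, which gives Cayley-Hamilton
  below.\<close>

lemma newton_vec_lower_tri:
  assumes A: "lower_tri d A" and b: "b \<in> carrier_vec d"
    and l: "\<And>i. i < d \<Longrightarrow> A $$ (i, i) = l i"
  shows "a < j \<Longrightarrow> a < d \<Longrightarrow> newton_vec l A b j $ a = 0"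
proof (induction j arbitrary: a)
  case (Suc j)
  let ?w = "newton_vec l A b j"
  note c = lower_tri_carrier[OF A]
  have w: "?w \<in> carrier_vec d" using c b by simp
  have *: "newton_vec l A b (Suc j) $ a = (A *\<^sub>v ?w) $ a - l j * ?w $ a"
    using c w Suc.prems by (simp del: index_mult_mat_vec)
  show ?case
  proof (cases "j < d")
    case True
    then show ?thesis
      using * Suc lower_tri_mult_vec_index[OF A w, of j] l[of j] by (cases "a = j") auto
  next
    case False
    then have "a < j" using Suc by simp
    moreover have "(A *\<^sub>v ?w) $ a = 0"
      unfolding mult_mat_vec_index_sum[OF c w Suc.prems(2)] using Suc.IH False by (intro sum.neutral) auto
    ultimately show ?thesis using * Suc by simp
  qed
qed simp

text \<open>The complete homogeneous polynomial \<^verbatim>\<open>(x^n - y^n) / (x - y)\<close>, also meaningful for \<^verbatim>\<open>x = y\<close>.\<close>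

primrec hom_sum :: "nat \<Rightarrow> 'a :: comm_ring_1 \<Rightarrow> 'a \<Rightarrow> 'a" where
  "hom_sum 0 x y = 0"
| "hom_sum (Suc n) x y = x * hom_sum n x y + y ^ n"

lemma hom_sum_diff: "(x - y) * hom_sum n x y = x ^ n - y ^ n"
proof (induction n)
  case (Suc n)
  have "(x - y) * hom_sum (Suc n) x y = x * ((x - y) * hom_sum n x y) + (x - y) * y ^ n"
    by (simp add: algebra_simps)
  then show ?case unfolding Suc by (simp add: algebra_simps)
qed simp

lemma hom_sum_same: "hom_sum n x x = of_nat n * x ^ (n - 1)"
proof (induction n)
  case (Suc n)
  then show ?case by (cases n) (simp_all add: algebra_simps)
qed simp

text \<open>\<open>H\<close> is A^(n-1) + A^(n-2) y + ... + y^(n-1), built by the recursion of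
  \<open>hom_sum\<close> with the matrix \<open>A\<close> in place of x. As a polynomial in
  \<open>A\<close> it commutes with \<open>A\<close>.\<close>

lemma lower_tri_power_diff_factor:
  assumes A: "lower_tri d A"
  shows "\<exists>H. lower_tri d H \<and> (\<forall>i<d. H $$ (i, i) = hom_sum n (A $$ (i, i)) y)
    \<and> A ^\<^sub>m n - y ^ n \<cdot>\<^sub>m 1\<^sub>m d = H * (A - y \<cdot>\<^sub>m 1\<^sub>m d) \<and> H * A = A * H"
proof (induction n)
  case 0
  have "A ^\<^sub>m 0 - y ^ 0 \<cdot>\<^sub>m 1\<^sub>m d = 0\<^sub>m d d * (A - y \<cdot>\<^sub>m 1\<^sub>m d)"
    using lower_tri_carrier[OF A] by (intro eq_matI) auto
  then show ?case using lower_tri_carrier[OF A]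
    by (intro exI[of _ "0\<^sub>m d d"]) (auto simp: lower_tri_def left_mult_zero_mat[of _ d] right_mult_zero_mat[of _ _ d])
next
  case (Suc n)
  then obtain H where H: "lower_tri d H" "\<And>i. i < d \<Longrightarrow> H $$ (i, i) = hom_sum n (A $$ (i, i)) y"
    "A ^\<^sub>m n - y ^ n \<cdot>\<^sub>m 1\<^sub>m d = H * (A - y \<cdot>\<^sub>m 1\<^sub>m d)" "H * A = A * H" by blast
  note c = lower_tri_carrier[OF A] lower_tri_carrier[OF H(1)]
  note AH = lower_tri_mult[OF A H(1)]
  let ?H = "A * H + y ^ n \<cdot>\<^sub>m 1\<^sub>m d"
  have "lower_tri d ?H" using AH(1) c unfolding lower_tri_def by (auto simp del: index_mult_mat)
  moreover have "\<forall>i<d. ?H $$ (i, i) = hom_sum (Suc n) (A $$ (i, i)) y"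
    using AH(2) H(2) c by (simp del: index_mult_mat(1))
  moreover have "A ^\<^sub>m Suc n - y ^ Suc n \<cdot>\<^sub>m 1\<^sub>m d = ?H * (A - y \<cdot>\<^sub>m 1\<^sub>m d)"
  proof -
    let ?I = "1\<^sub>m d :: 'a mat"
    let ?B = "A - y \<cdot>\<^sub>m ?I"
    have B: "?B \<in> carrier_mat d d" using c by auto
    have "?H * ?B = A * H * ?B + y ^ n \<cdot>\<^sub>m ?I * ?B"
      using c B by (intro add_mult_distrib_mat) auto
    also have "A * H * ?B = A * (H * ?B)"
      using c B by (intro assoc_mult_mat) auto
    also have "\<dots> = A * A ^\<^sub>m n - A * (y ^ n \<cdot>\<^sub>m ?I)"
      unfolding H(3)[symmetric] using c by (intro mult_minus_distrib_mat[of _ d d _ d]) auto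
    also have "A * A ^\<^sub>m n = A ^\<^sub>m Suc n" using pow_mat_Suc_left[OF c(1)] by simp
    also have "A * (y ^ n \<cdot>\<^sub>m ?I) = y ^ n \<cdot>\<^sub>m A"
      using c by (simp add: mult_smult_distrib[of _ d d _ d])
    also have "y ^ n \<cdot>\<^sub>m ?I * ?B = y ^ n \<cdot>\<^sub>m ?B"
      using B mult_smult_assoc_mat[of ?I d d ?B d] by simp
    also have "A ^\<^sub>m Suc n - y ^ n \<cdot>\<^sub>m A + y ^ n \<cdot>\<^sub>m ?B = A ^\<^sub>m Suc n - y ^ Suc n \<cdot>\<^sub>m ?I"
      using c pow_carrier_mat[OF c(1), of "Suc n"]
      by (intro eq_matI) (auto simp del: pow_mat.simps simp: algebra_simps)
    finally show ?thesis by simp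
  qed
  moreover have "?H * A = A * ?H"
    using c by (simp add: add_mult_distrib_mat[of _ d d] mult_add_distrib_mat[of _ d d _ d]
        assoc_mult_mat[of _ d d _ d _ d] mult_smult_assoc_mat[of _ d d] mult_smult_distrib[of _ d d _ d] H(4))
  ultimately show ?case by blast
qed

lemma commute_pow_mat:
  assumes A: "A \<in> carrier_mat d d" and B: "B \<in> carrier_mat d d" and "A * B = B * A"
  shows "A * B ^\<^sub>m n = B ^\<^sub>m n * A"
proof (induction n)
  case (Suc n)
  have "A * B ^\<^sub>m Suc n = (A * B ^\<^sub>m n) * B"
    using A B by (simp add: assoc_mult_mat[of _ d d _ d _ d])
  also have "\<dots> = B ^\<^sub>m n * (A * B)"
    unfolding Suc using A B by (simp add: assoc_mult_mat[of _ d d _ d _ d])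
  also have "\<dots> = B ^\<^sub>m Suc n * A"
    using A B assms(3) by (simp add: assoc_mult_mat[of _ d d _ d _ d])
  finally show ?case .
qed (use A B in simp)

lemma mult_mat_smult_vec:
  fixes A :: "'a :: comm_ring_1 mat"
  shows "A \<in> carrier_mat n m \<Longrightarrow> v \<in> carrier_vec m \<Longrightarrow> A *\<^sub>v (y \<cdot>\<^sub>v v) = y \<cdot>\<^sub>v (A *\<^sub>v v)"
  by (intro eq_vecI) auto

lemma smult_mat_mult_vec:
  fixes A :: "'a :: comm_ring_1 mat"
  shows "A \<in> carrier_mat n m \<Longrightarrow> v \<in> carrier_vec m \<Longrightarrow> (y \<cdot>\<^sub>m A) *\<^sub>v v = y \<cdot>\<^sub>v (A *\<^sub>v v)"
  by (intro eq_vecI) auto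

lemma minus_smult_one_mult_vec:
  fixes A :: "'a :: comm_ring_1 mat"
  shows "A \<in> carrier_mat d d \<Longrightarrow> v \<in> carrier_vec d \<Longrightarrow> (A - y \<cdot>\<^sub>m 1\<^sub>m d) *\<^sub>v v = A *\<^sub>v v - y \<cdot>\<^sub>v v"
  by (simp add: minus_mult_distrib_mat_vec[of A d d] smult_mat_mult_vec[of "1\<^sub>m d" d d])

text \<open>Each factor A^n - l_k^n of the Newton vector for A^n splits as H_k (A - l_k), and
  \<open>G\<close> collects the H_k with k < j. Commutation with \<open>A\<close> is carried along
  so that \<open>G\<close> can be moved past A^n.\<close>

lemma newton_vec_pow_lower_tri:
  assumes A: "lower_tri d A" and b: "b \<in> carrier_vec d"
    and l: "\<And>i. i < d \<Longrightarrow> A $$ (i, i) = l i"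
  shows "\<exists>G. lower_tri d G \<and> (\<forall>i<d. G $$ (i, i) = (\<Prod>k<j. hom_sum n (l i) (l k)))
    \<and> G * A = A * G \<and> newton_vec (\<lambda>i. l i ^ n) (A ^\<^sub>m n) b j = G *\<^sub>v newton_vec l A b j"
proof (induction j)
  case 0
  then show ?case
    using lower_tri_one[of d] lower_tri_carrier[OF A] b by (intro exI[of _ "1\<^sub>m d"]) auto
next
  case (Suc j)
  then obtain G where G: "lower_tri d G" "\<And>i. i < d \<Longrightarrow> G $$ (i, i) = (\<Prod>k<j. hom_sum n (l i) (l k))"
    "G * A = A * G" "newton_vec (\<lambda>i. l i ^ n) (A ^\<^sub>m n) b j = G *\<^sub>v newton_vec l A b j"
    by blast
  obtain H where H: "lower_tri d H" "\<And>i. i < d \<Longrightarrow> H $$ (i, i) = hom_sum n (A $$ (i, i)) (l j)"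
    "A ^\<^sub>m n - l j ^ n \<cdot>\<^sub>m 1\<^sub>m d = H * (A - l j \<cdot>\<^sub>m 1\<^sub>m d)"
    "H * A = A * H"
    using lower_tri_power_diff_factor[OF A, of n "l j"] by blast
  let ?I = "1\<^sub>m d :: 'a mat" and ?w = "newton_vec l A b j"
  note c = lower_tri_carrier[OF A] lower_tri_carrier[OF G(1)] lower_tri_carrier[OF H(1)]
  have w: "?w \<in> carrier_vec d" using c b by simp
  have pow: "G * A ^\<^sub>m n = A ^\<^sub>m n * G"
    by (rule commute_pow_mat[OF c(2,1) G(3)])
  have "newton_vec (\<lambda>i. l i ^ n) (A ^\<^sub>m n) b (Suc j) = A ^\<^sub>m n *\<^sub>v (G *\<^sub>v ?w) - l j ^ n \<cdot>\<^sub>v (G *\<^sub>v ?w)"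
    by (simp add: G(4))
  also have "A ^\<^sub>m n *\<^sub>v (G *\<^sub>v ?w) = G *\<^sub>v (A ^\<^sub>m n *\<^sub>v ?w)"
    using c w by (simp add: pow flip: assoc_mult_mat_vec[of _ d d _ d])
  also have "l j ^ n \<cdot>\<^sub>v (G *\<^sub>v ?w) = G *\<^sub>v (l j ^ n \<cdot>\<^sub>v ?w)"
    using c w by (simp add: mult_mat_smult_vec)
  also have "G *\<^sub>v (A ^\<^sub>m n *\<^sub>v ?w) - G *\<^sub>v (l j ^ n \<cdot>\<^sub>v ?w) = G *\<^sub>v (A ^\<^sub>m n *\<^sub>v ?w - l j ^ n \<cdot>\<^sub>v ?w)"
    using c w by (intro mult_minus_distrib_mat_vec[symmetric, of _ d d])
      (auto intro!: mult_mat_vec_carrier[of _ d d])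
  also have "A ^\<^sub>m n *\<^sub>v ?w - l j ^ n \<cdot>\<^sub>v ?w = (A ^\<^sub>m n - l j ^ n \<cdot>\<^sub>m ?I) *\<^sub>v ?w"
    using c w by (intro minus_smult_one_mult_vec[symmetric]) auto
  also have "\<dots> = H *\<^sub>v ((A - l j \<cdot>\<^sub>m ?I) *\<^sub>v ?w)"
    unfolding H(3) using c w by (intro assoc_mult_mat_vec[of _ d d _ d]) auto
  also have "(A - l j \<cdot>\<^sub>m ?I) *\<^sub>v ?w = newton_vec l A b (Suc j)"
    using c w by (simp add: minus_smult_one_mult_vec)
  also have "G *\<^sub>v (H *\<^sub>v newton_vec l A b (Suc j)) = (G * H) *\<^sub>v newton_vec l A b (Suc j)"
    using c b by (intro assoc_mult_mat_vec[symmetric, of _ d d _ d]) (auto simp del: newton_vec.simps)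
  finally have "newton_vec (\<lambda>i. l i ^ n) (A ^\<^sub>m n) b (Suc j) = (G * H) *\<^sub>v newton_vec l A b (Suc j)" .
  moreover have "G * H * A = A * (G * H)"
    by (metis assoc_mult_mat[OF c(2,3,1)] assoc_mult_mat[OF c(2,1,3)] assoc_mult_mat[OF c(1,2,3)] G(3) H(4))
  moreover have "\<forall>i<d. (G * H) $$ (i, i) = (\<Prod>k<Suc j. hom_sum n (l i) (l k))"
    using lower_tri_mult(2)[OF G(1) H(1)] G(2) H(2) l by (simp del: index_mult_mat(1))
  ultimately show ?case using lower_tri_mult(1)[OF G(1) H(1)] by blast
qed

lemma det_krylov_lower_tri:
  fixes A :: "'a :: comm_ring_1 mat"
  assumes A: "lower_tri d A" and b: "b \<in> carrier_vec d"
  shows "det (krylov d A b) = (\<Prod>i<d. newton_vec (\<lambda>i. A $$ (i, i)) A b i $ i)"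
proof -
  let ?l = "\<lambda>i. A $$ (i, i)"
  let ?N = "mat d d (\<lambda>(i, j). newton_vec ?l A b j $ i)"
  have "det ?N = prod_list (diag_mat ?N)"
    using newton_vec_lower_tri[OF A b, of ?l] by (intro det_lower_triangular[of d]) auto
  also have "diag_mat ?N = map (\<lambda>i. newton_vec ?l A b i $ i) [0..<d]"
    by (simp add: diag_mat_def)
  also have "prod_list \<dots> = (\<Prod>i<d. newton_vec ?l A b i $ i)"
    by (simp add: prod.distinct_set_conv_list[symmetric] lessThan_atLeast0)
  finally show ?thesis
    unfolding det_newton_vec_eq_krylov[OF lower_tri_carrier[OF A] b] .
qed

text \<open>The i-th Newton vector of A^n is \<open>G\<close> times that of \<open>A\<close>. The
  latter begins with i zeros, so its coordinate i is just multiplied by a diagonal entry of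
  \<open>G\<close>.\<close>

lemma det_krylov_pow_lower_tri:
  fixes A :: "'a :: comm_ring_1 mat"
  assumes A: "lower_tri d A" and b: "b \<in> carrier_vec d"
  shows "det (krylov d (A ^\<^sub>m n) b)
    = (\<Prod>i<d. \<Prod>j<i. hom_sum n (A $$ (i, i)) (A $$ (j, j))) * det (krylov d A b)"
proof -
  let ?l = "\<lambda>i. A $$ (i, i)"
  have L: "lower_tri d (A ^\<^sub>m n)" and diag: "\<And>i. i < d \<Longrightarrow> (A ^\<^sub>m n) $$ (i, i) = ?l i ^ n"
    using lower_tri_pow[OF A] by auto
  \<comment> \<open>The nodes are only known to agree below \<open>d\<close>; the i-th Newton vector
    uses the nodes below i, so \<open>i \<le> d\<close> is enough.\<close>
  have "newton_vec (\<lambda>i. (A ^\<^sub>m n) $$ (i, i)) (A ^\<^sub>m n) b i = newton_vec (\<lambda>i. ?l i ^ n) (A ^\<^sub>m n) b i"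
    if "i \<le> d" for i
    using that by (induction i) (simp_all add: diag)
  then have "det (krylov d (A ^\<^sub>m n) b) = (\<Prod>i<d. newton_vec (\<lambda>i. ?l i ^ n) (A ^\<^sub>m n) b i $ i)"
    unfolding det_krylov_lower_tri[OF L b] by (intro prod.cong) auto
  also have "\<dots> = (\<Prod>i<d. (\<Prod>j<i. hom_sum n (?l i) (?l j)) * newton_vec ?l A b i $ i)"
  proof (rule prod.cong)
    fix i assume "i \<in> {..<d}"
    then have i: "i < d" by simp
    obtain G where G: "lower_tri d G" "\<And>k. k < d \<Longrightarrow> G $$ (k, k) = (\<Prod>j<i. hom_sum n (?l k) (?l j))"
      "newton_vec (\<lambda>i. ?l i ^ n) (A ^\<^sub>m n) b i = G *\<^sub>v newton_vec ?l A b i"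
      using newton_vec_pow_lower_tri[OF A b, of ?l] by blast
    have "(G *\<^sub>v newton_vec ?l A b i) $ i = G $$ (i, i) * newton_vec ?l A b i $ i"
      using lower_tri_carrier[OF A] b newton_vec_lower_tri[OF A b, of ?l] i
      by (intro lower_tri_mult_vec_index(2)[OF G(1)]) auto
    then show "newton_vec (\<lambda>i. ?l i ^ n) (A ^\<^sub>m n) b i $ i
      = (\<Prod>j<i. hom_sum n (?l i) (?l j)) * newton_vec ?l A b i $ i"
      using G i by simp
  qed simp
  finally show ?thesis unfolding det_krylov_lower_tri[OF A b] prod.distrib .
qed

section \<open>Reduction to triangular form\<close>

lemma krylov_similar:
  assumes sim: "similar_mat_wit A L P Q" and A: "A \<in> carrier_mat d d" and b: "b \<in> carrier_vec d"
  shows "krylov d A b = P * krylov d L (Q *\<^sub>v b)"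
proof (rule eq_matI)
  note c = similar_mat_witD2[OF A sim]
  fix i j assume "i < dim_row (P * krylov d L (Q *\<^sub>v b))" "j < dim_col (P * krylov d L (Q *\<^sub>v b))"
  then have ij: "i < d" "j < d" using c by (auto simp: krylov_def)
  have "A ^\<^sub>m j *\<^sub>v b = P *\<^sub>v (L ^\<^sub>m j *\<^sub>v (Q *\<^sub>v b))"
    unfolding similar_mat_wit_pow_id[OF sim] using c b by (simp add: assoc_mult_mat_vec[of _ d d _ d])
  moreover have "(P * krylov d L (Q *\<^sub>v b)) $$ (i, j) = (P *\<^sub>v (L ^\<^sub>m j *\<^sub>v (Q *\<^sub>v b))) $ i"
  proof -
    have v: "L ^\<^sub>m j *\<^sub>v (Q *\<^sub>v b) \<in> carrier_vec d"
      using c b by (auto intro!: mult_mat_vec_carrier[of _ d d])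
    show ?thesis
      unfolding mult_mat_index_sum[OF c(6) krylov_carrier ij] mult_mat_vec_index_sum[OF c(6) v ij(1)]
      using ij by (intro sum.cong) (auto simp: krylov_def simp del: index_mult_mat_vec)
  qed
  ultimately show "krylov d A b $$ (i, j) = (P * krylov d L (Q *\<^sub>v b)) $$ (i, j)"
    using ij by (simp add: krylov_def del: index_mult_mat_vec)
qed (use similar_mat_witD2[OF A sim] in \<open>auto simp: krylov_def\<close>)

lemma newton_vec_similar:
  assumes sim: "similar_mat_wit A L P Q" and A: "A \<in> carrier_mat d d" and b: "b \<in> carrier_vec d"
  shows "newton_vec l A b j = P *\<^sub>v newton_vec l L (Q *\<^sub>v b) j"
proof (induction j)
  note c = similar_mat_witD2[OF A sim]
  case 0
  have "P *\<^sub>v (Q *\<^sub>v b) = (P * Q) *\<^sub>v b"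
    using c(6,7) b by (intro assoc_mult_mat_vec[symmetric, of _ d d _ d]) auto
  then show ?case using c b by simp
next
  note c = similar_mat_witD2[OF A sim]
  case (Suc j)
  let ?w = "newton_vec l L (Q *\<^sub>v b) j"
  have Qb: "Q *\<^sub>v b \<in> carrier_vec d" using c(7) b by (rule mult_mat_vec_carrier)
  have w: "?w \<in> carrier_vec d" using c(5) Qb by (rule newton_vec_carrier)
  have "A * P = P * L * (Q * P)"
    unfolding c(3) using c(5-7) by (intro assoc_mult_mat[of _ d d _ d _ d]) auto
  also have "\<dots> = P * L" using c(5-7) by (simp add: c(2))
  finally have "A * P = P * L" .
  moreover have "A *\<^sub>v (P *\<^sub>v ?w) = (A * P) *\<^sub>v ?w" "(P * L) *\<^sub>v ?w = P *\<^sub>v (L *\<^sub>v ?w)"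
    using A c(5,6) w by (simp_all add: assoc_mult_mat_vec[of _ d d _ d])
  ultimately have "A *\<^sub>v (P *\<^sub>v ?w) = P *\<^sub>v (L *\<^sub>v ?w)" by simp
  then have "newton_vec l A b (Suc j) = P *\<^sub>v (L *\<^sub>v ?w) - P *\<^sub>v (l j \<cdot>\<^sub>v ?w)"
    using c(6) w by (simp add: Suc mult_mat_smult_vec)
  also have "\<dots> = P *\<^sub>v (L *\<^sub>v ?w - l j \<cdot>\<^sub>v ?w)"
    using c w by (intro mult_minus_distrib_mat_vec[symmetric, of _ d d]) (auto intro: mult_mat_vec_carrier[of _ d d])
  finally show ?case by simp
qed

text \<open>Schur decomposition produces upper triangular matrices, so it is applied to the
  transpose, which has the same characteristic polynomial. The diagonal follows the order of
  \<open>es\<close>.\<close>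

lemma lower_triangularization:
  fixes A :: "'a :: conjugatable_ordered_field mat"
  assumes A: "A \<in> carrier_mat d d" and es: "char_poly A = (\<Prod>a\<leftarrow>es. [:- a, 1:])"
  obtains L P Q where "similar_mat_wit A L P Q" "lower_tri d L" "\<And>i. i < d \<Longrightarrow> L $$ (i, i) = es ! i"
proof -
  have AT: "transpose_mat A \<in> carrier_mat d d" using A by simp
  obtain T P Q where s: "schur_decomposition (transpose_mat A) es = (T, P, Q)"
    by (cases "schur_decomposition (transpose_mat A) es") auto
  have T: "similar_mat_wit (transpose_mat A) T P Q" "upper_triangular T" "diag_mat T = es"
    using schur_decomposition[OF AT _ s] es A by auto
  note c = similar_mat_witD2[OF AT T(1)]
  show thesis
  proof (rule that)
    show "similar_mat_wit A (transpose_mat T) (transpose_mat Q) (transpose_mat P)"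
    proof (rule similar_mat_witI[of _ _ d])
      show "transpose_mat Q * transpose_mat P = 1\<^sub>m d"
        using transpose_mult[OF c(6,7)] c(1) by simp
      show "transpose_mat P * transpose_mat Q = 1\<^sub>m d"
        using transpose_mult[OF c(7,6)] c(2) by simp
      have "A = transpose_mat (P * T * Q)" using c(3) by (metis transpose_transpose)
      also have "\<dots> = transpose_mat Q * (transpose_mat T * transpose_mat P)"
        using c by (simp add: transpose_mult[of _ d d _ d])
      finally show "A = transpose_mat Q * transpose_mat T * transpose_mat P"
        using c by (simp add: assoc_mult_mat[of _ d d _ d _ d])
    qed (use c A in auto)
    show "lower_tri d (transpose_mat T)"
      using c(5) T(2) by (auto simp: lower_tri_def upper_triangular_def)
    show "transpose_mat T $$ (i, i) = es ! i" if "i < d" for i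
      using that c(5) unfolding T(3)[symmetric] by (simp add: diag_mat_def)
  qed
qed

text \<open>The factor \<open>det P\<close> from the similarity is the same for \<open>A\<close> and
  for A^n. The eigenvalue product does not involve \<open>b\<close>, which later allows one
  \<open>b\<close> to serve for all \<open>n\<close>.\<close>

theorem det_krylov_pow:
  fixes A :: "'a :: conjugatable_ordered_field mat"
  assumes A: "A \<in> carrier_mat d d" and es: "char_poly A = (\<Prod>a\<leftarrow>es. [:- a, 1:])"
    and b: "b \<in> carrier_vec d"
  shows "det (krylov d (A ^\<^sub>m n) b)
    = (\<Prod>i<d. \<Prod>j<i. hom_sum n (es ! i) (es ! j)) * det (krylov d A b)"
proof -
  obtain L P Q where L: "similar_mat_wit A L P Q" "lower_tri d L" "\<And>i. i < d \<Longrightarrow> L $$ (i, i) = es ! i"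
    using lower_triangularization[OF A es] by blast
  note c = similar_mat_witD2[OF A L(1)]
  have Qb: "Q *\<^sub>v b \<in> carrier_vec d" using c(7) b by (rule mult_mat_vec_carrier)
  have An: "A ^\<^sub>m n \<in> carrier_mat d d" using A by simp
  have "det (krylov d (A ^\<^sub>m n) b) = det P * det (krylov d (L ^\<^sub>m n) (Q *\<^sub>v b))"
    unfolding krylov_similar[OF similar_mat_wit_pow[OF L(1)] An b] by (rule det_mult[OF c(6) krylov_carrier])
  also have "\<dots> = (\<Prod>i<d. \<Prod>j<i. hom_sum n (L $$ (i, i)) (L $$ (j, j))) * (det P * det (krylov d L (Q *\<^sub>v b)))"
    unfolding det_krylov_pow_lower_tri[OF L(2) Qb] by simp
  also have "det P * det (krylov d L (Q *\<^sub>v b)) = det (krylov d A b)"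
    unfolding krylov_similar[OF L(1) A b] by (rule det_mult[OF c(6) krylov_carrier, symmetric])
  also have "(\<Prod>i<d. \<Prod>j<i. hom_sum n (L $$ (i, i)) (L $$ (j, j)))
    = (\<Prod>i<d. \<Prod>j<i. hom_sum n (es ! i) (es ! j))"
    by (intro prod.cong) (auto simp: L(3))
  finally show ?thesis .
qed

section \<open>Cayley-Hamilton and integral Krylov lattices\<close>

text \<open>The Newton polynomial whose nodes are all d eigenvalues is the characteristic
  polynomial, and the d-th Newton vector of the triangular form is zero.\<close>

lemma cayley_hamilton_vec_complex:
  fixes A :: "complex mat"
  assumes A: "A \<in> carrier_mat d d" and b: "b \<in> carrier_vec d" and a: "a < d"
  shows "(\<Sum>i\<le>d. coeff (char_poly A) i * (A ^\<^sub>m i *\<^sub>v b) $ a) = 0"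
proof -
  obtain es where es: "char_poly A = (\<Prod>a\<leftarrow>es. [:- a, 1:])" "length es = d"
    using char_poly_factorized[OF A] by blast
  obtain L P Q where L: "similar_mat_wit A L P Q" "lower_tri d L" "\<And>i. i < d \<Longrightarrow> L $$ (i, i) = es ! i"
    using lower_triangularization[OF A es(1)] by blast
  note c = similar_mat_witD2[OF A L(1)]
  have Qb: "Q *\<^sub>v b \<in> carrier_vec d" using c(7) b by (rule mult_mat_vec_carrier)
  have "newton_poly ((!) es) d = char_poly A"
    unfolding newton_poly_def es(1) using es(2)
    by (simp add: prod.list_conv_set_nth lessThan_atLeast0)
  moreover have "newton_vec ((!) es) L (Q *\<^sub>v b) d = 0\<^sub>v d"
    using newton_vec_lower_tri[OF L(2) Qb, of "(!) es" _ d] L(3) newton_vec_carrier[OF c(5) Qb, of "(!) es" d]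
    by (intro eq_vecI) auto
  then have "newton_vec ((!) es) A b d = 0\<^sub>v d"
    unfolding newton_vec_similar[OF L(1) A b] using c(6) by (auto intro!: eq_vecI)
  ultimately show ?thesis using newton_vec_index[OF A b a, of "(!) es" d] a by simp
qed

lemma cayley_hamilton_vec_int:
  fixes A :: "int mat"
  assumes A: "A \<in> carrier_mat d d" and b: "b \<in> carrier_vec d" and a: "a < d"
  shows "(\<Sum>i\<le>d. coeff (char_poly A) i * (A ^\<^sub>m i *\<^sub>v b) $ a) = 0"
proof -
  let ?A = "map_mat of_int A :: complex mat" and ?b = "map_vec of_int b :: complex vec"
  have x: "(?A ^\<^sub>m i *\<^sub>v ?b) $ a = of_int ((A ^\<^sub>m i *\<^sub>v b) $ a)" for i
  proof -
    have "?A ^\<^sub>m i *\<^sub>v ?b = map_vec of_int (A ^\<^sub>m i *\<^sub>v b)"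
      using A b by (simp add: of_int_hom.mult_mat_vec_hom[of _ d d] of_int_hom.mat_hom_pow)
    then show ?thesis using A a by simp
  qed
  have "(\<Sum>i\<le>d. coeff (char_poly ?A) i * (?A ^\<^sub>m i *\<^sub>v ?b) $ a) = 0"
    using A b a by (intro cayley_hamilton_vec_complex) auto
  then have "(\<Sum>i\<le>d. of_int (coeff (char_poly A) i * (A ^\<^sub>m i *\<^sub>v b) $ a)) = (0 :: complex)"
    unfolding x of_int_hom.char_poly_hom[OF A] by (simp del: index_mult_mat_vec)
  then show ?thesis unfolding of_int_sum[symmetric] of_int_eq_0_iff .
qed

text \<open>\<open>A\<close> sends each column to the next, and Cayley-Hamilton rewrites A^d b. Thus
  \<open>C\<close> is the companion matrix; it is integral because the characteristic polynomial is
  monic over the integers.\<close>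

lemma krylov_companion:
  fixes A :: "int mat"
  assumes A: "A \<in> carrier_mat d d" and b: "b \<in> carrier_vec d"
  obtains C where "C \<in> carrier_mat d d" "A * krylov d A b = krylov d A b * C"
proof -
  let ?c = "coeff (char_poly A)" and ?x = "\<lambda>i. A ^\<^sub>m i *\<^sub>v b"
  define C where "C = mat d d (\<lambda>(i, j). if Suc j < d then (if i = Suc j then 1 else 0) else - ?c i)"
  have C: "C \<in> carrier_mat d d" by (simp add: C_def)
  have "A * krylov d A b = krylov d A b * C"
  proof (rule eq_matI)
    fix i j assume "i < dim_row (krylov d A b * C)" "j < dim_col (krylov d A b * C)"
    then have ij: "i < d" "j < d" by (simp_all add: C_def krylov_def)
    have xc: "?x k \<in> carrier_vec d" for k
      using A b by (intro mult_mat_vec_carrier[of _ d d]) auto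
    have "(A * krylov d A b) $$ (i, j) = (A *\<^sub>v ?x j) $ i"
      unfolding mult_mat_index_sum[OF A krylov_carrier ij] mult_mat_vec_index_sum[OF A xc ij(1)]
      using ij by (intro sum.cong) (auto simp: krylov_def simp del: index_mult_mat_vec)
    also have "A *\<^sub>v ?x j = ?x (Suc j)"
      using A b by (simp add: pow_mat_Suc_left[OF A] assoc_mult_mat_vec[of _ d d _ d] del: pow_mat.simps)
    also have "?x (Suc j) $ i = (krylov d A b * C) $$ (i, j)"
    proof (cases "Suc j < d")
      case True
      have "(krylov d A b * C) $$ (i, j) = (\<Sum>k<d. if k = Suc j then ?x k $ i else 0)"
        unfolding mult_mat_index_sum[OF krylov_carrier C ij]
        using ij True by (intro sum.cong) (auto simp: krylov_def C_def simp del: index_mult_mat_vec)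
      then show ?thesis using True by (simp del: index_mult_mat_vec pow_mat.simps)
    next
      case False
      then have d: "d = Suc j" using ij by simp
      have "(krylov d A b * C) $$ (i, j) = (\<Sum>k<d. ?x k $ i * - ?c k)"
        unfolding mult_mat_index_sum[OF krylov_carrier C ij]
        using ij False by (intro sum.cong) (auto simp: krylov_def C_def simp del: index_mult_mat_vec)
      also have "\<dots> = - (\<Sum>k<d. ?c k * ?x k $ i)"
        by (simp add: sum_negf mult.commute del: index_mult_mat_vec)
      also have "\<dots> = ?c d * ?x d $ i"
        using cayley_hamilton_vec_int[OF A b ij(1)] by (simp add: lessThan_Suc_atMost[symmetric] del: index_mult_mat_vec)
      also have "?c d = 1" using degree_monic_char_poly[OF A] by metis
      finally show ?thesis by (simp add: d del: index_mult_mat_vec pow_mat.simps)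
    qed
    finally show "(A * krylov d A b) $$ (i, j) = (krylov d A b * C) $$ (i, j)" .
  qed (use A in \<open>simp_all add: C_def krylov_def\<close>)
  with C show thesis by (rule that)
qed

text \<open>The columns A^(n j) b lie in the lattice spanned by the columns of \<open>?K\<close>.
  Hence a \<open>b\<close> that is unimodular for A^n is so for \<open>A\<close>.\<close>

lemma det_krylov_dvd_det_krylov_pow:
  fixes A :: "int mat"
  assumes A: "A \<in> carrier_mat d d" and b: "b \<in> carrier_vec d"
  shows "det (krylov d A b) dvd det (krylov d (A ^\<^sub>m n) b)"
proof (cases "d = 0")
  case True
  then show ?thesis by (simp add: krylov_def)
next
  case False
  let ?K = "krylov d A b"
  obtain C where C: "C \<in> carrier_mat d d" "A * ?K = ?K * C"
    using krylov_companion[OF A b] by blast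
  have pow: "A ^\<^sub>m m * ?K = ?K * C ^\<^sub>m m" for m
  proof (induction m)
    case (Suc m)
    have "A ^\<^sub>m Suc m * ?K = A ^\<^sub>m m * (A * ?K)"
      using A by (simp add: assoc_mult_mat[of _ d d _ d _ d])
    also have "\<dots> = (A ^\<^sub>m m * ?K) * C"
      unfolding C(2) using A C by (simp add: assoc_mult_mat[of _ d d _ d _ d])
    also have "\<dots> = ?K * C ^\<^sub>m Suc m"
      unfolding Suc using C by (simp add: assoc_mult_mat[of _ d d _ d _ d])
    finally show ?case .
  qed (use A C in \<open>simp add: left_mult_one_mat[of _ d d] right_mult_one_mat[of _ d d]\<close>)
  \<comment> \<open>\<open>b\<close> is the first column of \<open>?K\<close>, so A^(n j) b is
    \<open>?K\<close> times the first column of C^(n j).\<close>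
  define U where "U = mat d d (\<lambda>(i, j). (C ^\<^sub>m (n * j)) $$ (i, 0))"
  have U: "U \<in> carrier_mat d d" by (simp add: U_def)
  have "krylov d (A ^\<^sub>m n) b = ?K * U"
  proof (rule eq_matI)
    fix i j assume "i < dim_row (?K * U)" "j < dim_col (?K * U)"
    then have ij: "i < d" "j < d" by (simp_all add: U_def krylov_def)
    have "krylov d (A ^\<^sub>m n) b $$ (i, j) = (A ^\<^sub>m (n * j) *\<^sub>v b) $ i"
      using ij by (simp add: krylov_def pow_mat_mult[OF A] del: index_mult_mat_vec)
    also have "\<dots> = (A ^\<^sub>m (n * j) * ?K) $$ (i, 0)"
    proof -
      have "col ?K 0 = b"
        using False A b by (intro eq_vecI) (auto simp: krylov_def)
      then show ?thesis using A ij False by (simp add: krylov_def)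
    qed
    also have "\<dots> = (?K * U) $$ (i, j)"
      unfolding pow mult_mat_index_sum[OF krylov_carrier U ij]
        mult_mat_index_sum[OF krylov_carrier pow_carrier_mat[OF C(1)] ij(1), of 0, OF False[unfolded neq0_conv]]
      using ij by (intro sum.cong) (auto simp: U_def)
    finally show "krylov d (A ^\<^sub>m n) b $$ (i, j) = (?K * U) $$ (i, j)" .
  qed (simp_all add: U_def krylov_def)
  then show ?thesis by (simp add: det_mult[OF krylov_carrier U])
qed

section \<open>Growth along arithmetic progressions\<close>

lemma common_convergent_subsequence:
  fixes f :: "'a \<Rightarrow> nat \<Rightarrow> real"
  assumes "finite I" "\<And>i. i \<in> I \<Longrightarrow> Bseq (f i)"
  shows "\<exists>s :: nat \<Rightarrow> nat. strict_mono s \<and> (\<forall>i\<in>I. convergent (f i \<circ> s))"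
  using assms
proof (induction rule: finite_induct)
  case empty
  then show ?case using strict_mono_id by blast
next
  case (insert x I)
  have "\<exists>s :: nat \<Rightarrow> nat. strict_mono s \<and> (\<forall>i\<in>I. convergent (f i \<circ> s))"
    by (rule insert.IH) (rule insert.prems, simp)
  then obtain s :: "nat \<Rightarrow> nat" where s: "strict_mono s" "\<And>i. i \<in> I \<Longrightarrow> convergent (f i \<circ> s)"
    by blast
  obtain t :: "nat \<Rightarrow> nat" where t: "strict_mono t" "monoseq (\<lambda>n. (f x \<circ> s) (t n))"
    using seq_monosub[of "f x \<circ> s"] by blast
  have "Bseq (\<lambda>n. (f x \<circ> s) (t n))"
    using insert.prems[of x] by (auto simp: Bseq_def)
  then have "convergent (f x \<circ> (s \<circ> t))"
    using t(2) Bseq_monoseq_convergent by (simp add: o_def)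
  moreover have "convergent (f i \<circ> (s \<circ> t))" if "i \<in> I" for i
    using convergent_subseq_convergent[OF s(2)[OF that] t(1)] by (simp add: o_assoc)
  ultimately show ?case using strict_mono_o[OF s(1) t(1)] by blast
qed

text \<open>Compactness of the torus: along a common convergent subsequence of powers, the quotient
  of two late terms is again a power, with the same exponent for all i, and is close to 1.\<close>

lemma unit_powers_recurrent:
  fixes z :: "nat \<Rightarrow> complex"
  assumes z: "\<And>i. i < d \<Longrightarrow> cmod (z i) = 1" and e: "e > 0"
  shows "\<exists>k\<ge>B. \<forall>i<d. cmod (z i ^ k - 1) < e"
proof -
  let ?f = "\<lambda>(g, i) m. g (z i ^ m) :: real"
  have "Bseq (?f x)" if "x \<in> {Re, Im} \<times> {..<d}" for x
  proof -
    obtain g i where x: "x = (g, i)" "g = Re \<or> g = Im" "i < d" using \<open>x \<in> _\<close> by auto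
    have "\<bar>g (z i ^ m)\<bar> \<le> 1" for m
      using abs_Re_le_cmod[of "z i ^ m"] abs_Im_le_cmod[of "z i ^ m"] x z[of i]
      by (auto simp: norm_power)
    then show ?thesis using x by (intro BseqI[of 1]) auto
  qed
  then have "\<exists>s :: nat \<Rightarrow> nat. strict_mono s \<and> (\<forall>x\<in>{Re, Im} \<times> {..<d}. convergent (?f x \<circ> s))"
    by (intro common_convergent_subsequence) auto
  then obtain s :: "nat \<Rightarrow> nat" where s: "strict_mono s"
      "\<And>x. x \<in> {Re, Im} \<times> {..<d} \<Longrightarrow> convergent (?f x \<circ> s)"
    by blast
  have "\<exists>M. \<forall>m\<ge>M. \<forall>n\<ge>M. cmod (z i ^ s m - z i ^ s n) < e" if "i < d" for i
  proof -
    have "Cauchy (\<lambda>m. Re (z i ^ s m))" "Cauchy (\<lambda>m. Im (z i ^ s m))"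
      using s(2)[of "(Re, i)"] s(2)[of "(Im, i)"] \<open>i < d\<close>
      by (auto simp: Cauchy_convergent_iff o_def)
    then obtain M1 M2 where M: "\<And>m n. m \<ge> M1 \<Longrightarrow> n \<ge> M1 \<Longrightarrow> \<bar>Re (z i ^ s m) - Re (z i ^ s n)\<bar> < e / 2"
      "\<And>m n. m \<ge> M2 \<Longrightarrow> n \<ge> M2 \<Longrightarrow> \<bar>Im (z i ^ s m) - Im (z i ^ s n)\<bar> < e / 2"
      using e unfolding Cauchy_iff real_norm_def by (metis half_gt_zero)
    have "cmod (z i ^ s m - z i ^ s n) < e" if "m \<ge> max M1 M2" "n \<ge> max M1 M2" for m n
      using cmod_le[of "z i ^ s m - z i ^ s n"] M(1)[of m n] M(2)[of m n] that by simp
    then show ?thesis by blast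
  qed
  then obtain M where M: "\<And>i m n. i < d \<Longrightarrow> m \<ge> M i \<Longrightarrow> n \<ge> M i \<Longrightarrow> cmod (z i ^ s m - z i ^ s n) < e"
    by metis
  define m where "m = (\<Sum>i<d. M i)"
  have m: "M i \<le> m" if "i < d" for i
    unfolding m_def using that by (intro member_le_sum) auto
  \<comment> \<open>Since \<open>s n \<ge> n\<close>, this makes the exponent
    \<open>s n - s m\<close> at least \<open>B\<close>.\<close>
  define n where "n = m + (s m + B)"
  have n: "s n \<ge> s m + B"
    using seq_suble[OF s(1), of n] by (simp add: n_def)
  have "cmod (z i ^ (s n - s m) - 1) < e" if i: "i < d" for i
  proof -
    have "z i ^ s n - z i ^ s m = z i ^ s m * (z i ^ (s n - s m) - 1)"
      using n by (simp add: right_diff_distrib flip: power_add)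
    then have "cmod (z i ^ (s n - s m) - 1) = cmod (z i ^ s n - z i ^ s m)"
      using z[OF i] by (simp add: norm_mult norm_power)
    then show ?thesis using M[OF i, of n m] m[OF i] by (simp add: n_def)
  qed
  then show ?thesis using n by (intro exI[of _ "s n - s m"]) simp
qed

section \<open>Growth of products over pairs of eigenvalues\<close>

text \<open>Each x_i occurs in d - 1 pairs; the extra product on the left avoids the exponent d -
  1.\<close>

lemma prod_over_pairs:
  fixes x :: "nat \<Rightarrow> 'a :: comm_monoid_mult"
  shows "(\<Prod>i<d. \<Prod>j<i. x i * x j) * (\<Prod>i<d. x i) = (\<Prod>i<d. x i) ^ d"
proof (induction d)
  case (Suc d)
  let ?P = "\<Prod>i<d. x i"
  have "(\<Prod>i<Suc d. \<Prod>j<i. x i * x j) * (\<Prod>i<Suc d. x i)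
      = ((\<Prod>i<d. \<Prod>j<i. x i * x j) * ?P) * (x d ^ d * ?P * x d)"
    by (simp add: prod.distrib mult_ac)
  also have "\<dots> = ?P ^ d * (x d ^ d * ?P * x d)"
    by (simp only: Suc)
  also have "\<dots> = (?P * x d) ^ Suc d"
    by (simp add: power_mult_distrib mult_ac)
  finally show ?case by simp
qed simp

text \<open>x_i x_j is at most the square of the larger of the two, strictly if they differ. The
  products x_i x_j multiply to 1 over all pairs, so one unequal pair would push the product of the
  maxima above 1.\<close>

lemma prod_max_pairs_le_1_imp_eq_1:
  fixes x :: "nat \<Rightarrow> real"
  assumes pos: "\<And>i. i < d \<Longrightarrow> x i > 0" and one: "(\<Prod>i<d. x i) = 1"
    and le: "(\<Prod>i<d. \<Prod>j<i. max (x i) (x j)) \<le> 1"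
  shows "i < d \<Longrightarrow> x i = 1"
proof -
  define P where "P = (SIGMA i:{..<d}. {..<i})"
  have finP: "finite P" by (simp add: P_def)
  have prodP: "(\<Prod>i<d. \<Prod>j<i. g i j) = (\<Prod>(i, j)\<in>P. g i j)" for g :: "nat \<Rightarrow> nat \<Rightarrow> real"
    unfolding P_def by (subst prod.Sigma) auto
  have P: "x i > 0" "x j > 0" if "(i, j) \<in> P" for i j
    using that pos by (auto simp: P_def)
  have eq: "x i = x j" if ij: "(i, j) \<in> P" for i j
  proof (rule ccontr)
    assume ne: "x i \<noteq> x j"
    let ?g = "\<lambda>(i, j). x i * x j" and ?h = "\<lambda>(i, j). max (x i) (x j) ^ 2"
    have le': "?g y \<le> ?h y" "0 < ?g y" if "y \<in> P" for y
    proof -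
      obtain a b where y: "y = (a, b)" by fastforce
      show "?g y \<le> ?h y" "0 < ?g y"
        using that P[of a b] unfolding y by (auto simp: power2_eq_square intro!: mult_mono)
    qed
    have lt: "?g (i, j) < ?h (i, j)"
      using P[OF ij] ne by (cases "x i < x j") (auto simp: power2_eq_square max_def intro: mult_strict_right_mono mult_strict_left_mono)
    have "(\<Prod>y\<in>P. ?g y) = ?g (i, j) * (\<Prod>y\<in>P - {(i, j)}. ?g y)"
      by (rule prod.remove[OF finP ij])
    also have "\<dots> < ?h (i, j) * (\<Prod>y\<in>P - {(i, j)}. ?g y)"
      using lt le'(2) by (intro mult_strict_right_mono prod_pos) auto
    also have "\<dots> \<le> ?h (i, j) * (\<Prod>y\<in>P - {(i, j)}. ?h y)"
      using le' by (intro mult_left_mono prod_mono) (auto simp: less_imp_le)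
    also have "\<dots> = (\<Prod>y\<in>P. ?h y)"
      by (rule prod.remove[OF finP ij, symmetric])
    also have "\<dots> = (\<Prod>(i, j)\<in>P. max (x i) (x j)) ^ 2"
      by (simp add: prod_power_distrib case_prod_unfold)
    also have "\<dots> \<le> 1"
      using le P unfolding prodP by (intro power_le_one prod_nonneg) (auto simp: less_imp_le le_max_iff_disj)
    finally have "(\<Prod>i<d. \<Prod>j<i. x i * x j) < 1" unfolding prodP by simp
    then show False using prod_over_pairs[of x d] one by simp
  qed
  show "x i = 1" if i: "i < d" for i
  proof -
    have "x k = x i" if "k < d" for k
    proof (cases k i rule: linorder_cases)
      case less
      then show ?thesis using eq[of i k] that i by (simp add: P_def)
    next
      case greater
      then show ?thesis using eq[of k i] that i by (simp add: P_def)
    qed simp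
    then have "(\<Prod>k<d. x k) = x i ^ d" by simp
    then show ?thesis using i pos[OF i] one power_eq_iff_eq_base[of d "x i" 1] by simp
  qed
qed

text \<open>Along exponents for which the phases nearly repeat, each factor grows at least like a
  power of the larger modulus, times a linear term if the two eigenvalues coincide. As the product
  keeps modulus 1, excluding exponential growth gives modulus 1 everywhere, and then excluding
  linear growth gives distinctness.\<close>

lemma hom_sum_product_growth:
  fixes l :: "nat \<Rightarrow> complex"
  assumes N: "N > 0" and det: "(\<Prod>i<d. cmod (l i)) = 1"
    and one: "\<And>k. cmod (\<Prod>i<d. \<Prod>j<i. hom_sum (r + N * k) (l i) (l j)) = 1"
  shows "inj_on l {..<d}" and "\<And>i. i < d \<Longrightarrow> cmod (l i) = 1"
proof -
  define P where "P = (SIGMA i:{..<d}. {..<i})"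
  have finP: "finite P" by (simp add: P_def)
  have prodP: "(\<Prod>i<d. \<Prod>j<i. g i j) = (\<Prod>(i, j)\<in>P. g i j)" for g :: "nat \<Rightarrow> nat \<Rightarrow> complex"
    unfolding P_def by (subst prod.Sigma) auto
  have prodPr: "(\<Prod>i<d. \<Prod>j<i. g i j) = (\<Prod>(i, j)\<in>P. g i j)" for g :: "nat \<Rightarrow> nat \<Rightarrow> real"
    unfolding P_def by (subst prod.Sigma) auto
  have P: "i < d" "j < d" "j < i" if "(i, j) \<in> P" for i j
    using that by (auto simp: P_def)
  define x where "x i = cmod (l i)" for i
  have x: "x i > 0" if "i < d" for i
    using det that prod_zero[of "{..<d}" "\<lambda>i. cmod (l i)"] by (auto simp: x_def)
  \<comment> \<open>The phase is raised to the power \<open>N\<close>, so that recurrence of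
    \<open>t\<close> yields exponents that are multiples of \<open>N\<close>.\<close>
  define t where "t i = (l i / of_real (x i)) ^ N" for i
  have t: "cmod (t i) = 1" if "i < d" for i
    using x[OF that] by (auto simp: t_def norm_power norm_divide x_def)
  have "\<forall>m. \<exists>k\<ge>m. \<forall>i<d. cmod (t i ^ k - 1) < inverse (real (Suc m))"
    using unit_powers_recurrent[of d t, OF t] by simp
  then obtain \<kappa> where \<kappa>: "\<And>m. \<kappa> m \<ge> m" "\<And>m i. i < d \<Longrightarrow> cmod (t i ^ \<kappa> m - 1) < inverse (real (Suc m))"
    by metis
  have lim_t: "(\<lambda>m. t i ^ \<kappa> m) \<longlonglongrightarrow> 1" if "i < d" for i
  proof (rule metric_tendsto_imp_tendsto[OF LIMSEQ_inverse_real_of_nat])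
    show "\<forall>\<^sub>F m in sequentially. dist (t i ^ \<kappa> m) 1 \<le> dist (inverse (real (Suc m))) 0"
      using \<kappa>(2)[OF that] by (intro always_eventually) (simp add: dist_norm less_imp_le)
  qed
  define X where "X m = N * \<kappa> m" for m
  have "X m \<ge> m" for m using \<kappa>(1)[of m] N unfolding X_def by (metis le_trans mult_le_mono1 mult_1 Suc_leI One_nat_def)
  then have X: "filterlim X at_top sequentially"
    by (intro filterlim_at_top_mono[OF filterlim_ident]) auto
  have power_l: "l i ^ (r + X m) = l i ^ r * of_real (x i ^ X m) * t i ^ \<kappa> m" if "i < d" for i m
    using x[OF that] by (simp add: t_def X_def power_add power_mult power_divide power_mult_distrib)
  have one': "cmod (\<Prod>(i, j)\<in>P. hom_sum (r + X m) (l i) (l j)) = 1" for m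
    using one[of "\<kappa> m"] unfolding prodP X_def .
  \<comment> \<open>Read off from the case \<open>k = 0\<close> of the hypothesis; it keeps the two
    leading terms below from cancelling in the limit.\<close>
  have ne: "l i ^ r \<noteq> l j ^ r" if "(i, j) \<in> P" "l i \<noteq> l j" for i j
  proof -
    have "(\<Prod>(i, j)\<in>P. hom_sum r (l i) (l j)) \<noteq> 0"
      using one[of 0] unfolding prodP by auto
    then have "hom_sum r (l i) (l j) \<noteq> 0" using that(1) finP by (auto simp: prod_zero_iff)
    then show ?thesis using hom_sum_diff[of "l i" "l j" r] that(2) by auto
  qed
  \<comment> \<open>\<open>\<mu>\<close> is the exponential rate of a factor; \<open>E\<close>
    records the linear growth in \<open>hom_sum_same\<close>.\<close>
  define \<mu> where "\<mu> i j = max (x i) (x j)" for i j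
  define E where "E i j m = (if l i = l j then real (X m) else 1)" for i j m
  have bound: "\<exists>c>0. \<forall>\<^sub>F m in sequentially. cmod (hom_sum (r + X m) (l i) (l j)) \<ge> c * (\<mu> i j ^ X m * E i j m)"
    if ij: "(i, j) \<in> P" for i j
  proof (cases "l i = l j")
    case True
    have xi: "x i > 0" using x P(1)[OF ij] by blast
    have "cmod (hom_sum (r + X m) (l i) (l j)) \<ge> x i ^ r / x i * (\<mu> i j ^ X m * E i j m)"
      if "X m \<ge> 1" for m
    proof -
      have "cmod (hom_sum (r + X m) (l i) (l j)) = real (r + X m) * x i ^ (r + X m - 1)"
        unfolding True[symmetric] hom_sum_same by (simp add: norm_mult norm_power x_def flip: of_nat_add)
      also have "x i ^ (r + X m - 1) = x i ^ r / x i * x i ^ X m"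
        using xi that by (simp add: power_diff power_add)
      also have "real (r + X m) * (x i ^ r / x i * x i ^ X m) \<ge> real (X m) * (x i ^ r / x i * x i ^ X m)"
        using xi by (intro mult_right_mono) auto
      finally show ?thesis using True by (simp add: \<mu>_def E_def x_def mult_ac)
    qed
    moreover have "\<forall>\<^sub>F m in sequentially. X m \<ge> 1"
      using X by (simp add: filterlim_at_top)
    ultimately show ?thesis using xi
      by (intro exI[of _ "x i ^ r / x i"]) (auto elim!: eventually_mono)
  next
    case False
    \<comment> \<open>After scaling by \<open>\<mu> i j ^ X m\<close>, only an eigenvalue of the
      larger modulus has a nonzero limit, namely its r-th power, because the phases tend to
      1.\<close>
    define w where "w k = l k ^ r * (if x k = \<mu> i j then 1 else 0)" for k
    have lim: "(\<lambda>m. l k ^ (r + X m) / of_real (\<mu> i j ^ X m)) \<longlonglongrightarrow> w k" if k: "k = i \<or> k = j" for k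
    proof -
      have kd: "k < d" using k P[OF ij] by auto
      have "\<mu> i j > 0" using x P(1)[OF ij] by (auto simp: \<mu>_def less_max_iff_disj)
      have "(\<lambda>m. (x k / \<mu> i j) ^ X m) \<longlonglongrightarrow> (if x k = \<mu> i j then 1 else 0)"
      proof (cases "x k = \<mu> i j")
        case False
        then have "x k < \<mu> i j" using k by (auto simp: \<mu>_def)
        then have "(\<lambda>n. (x k / \<mu> i j) ^ n) \<longlonglongrightarrow> 0"
          using \<open>\<mu> i j > 0\<close> x[OF kd] by (intro LIMSEQ_realpow_zero) auto
        then show ?thesis using False filterlim_compose[OF _ X] by auto
      qed (use \<open>\<mu> i j > 0\<close> in simp)
      from tendsto_of_real[OF this, where ?'a = complex]
      have "(\<lambda>m. complex_of_real ((x k / \<mu> i j) ^ X m)) \<longlonglongrightarrow> (if x k = \<mu> i j then 1 else 0)"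
        by (cases "x k = \<mu> i j") (simp_all only: if_True if_False of_real_0 of_real_1 refl)
      then have "(\<lambda>m. l k ^ r * of_real ((x k / \<mu> i j) ^ X m) * t k ^ \<kappa> m) \<longlonglongrightarrow> w k * 1"
        unfolding w_def by (intro tendsto_mult lim_t[OF kd] tendsto_const)
      then show ?thesis by (simp add: power_l[OF kd] power_divide field_simps)
    qed
    \<comment> \<open>If the moduli agree, \<open>ne\<close> applies; otherwise exactly one of the
      two limits is nonzero.\<close>
    have "w i - w j \<noteq> 0"
      using ne[OF ij False] x[OF P(1)[OF ij]] x[OF P(2)[OF ij]]
      by (auto simp: w_def \<mu>_def x_def max_def)
    moreover have "(\<lambda>m. cmod (l i ^ (r + X m) / of_real (\<mu> i j ^ X m) - l j ^ (r + X m) / of_real (\<mu> i j ^ X m)))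
        \<longlonglongrightarrow> cmod (w i - w j)"
      by (intro tendsto_norm tendsto_diff lim) auto
    ultimately have ev: "\<forall>\<^sub>F m in sequentially. cmod (l i ^ (r + X m) / of_real (\<mu> i j ^ X m) - l j ^ (r + X m) / of_real (\<mu> i j ^ X m))
        > cmod (w i - w j) / 2"
      by (intro order_tendstoD(1)) auto
    let ?c = "cmod (w i - w j) / 2 / cmod (l i - l j)"
    have "cmod (hom_sum (r + X m) (l i) (l j)) \<ge> ?c * (\<mu> i j ^ X m * E i j m)"
      if m: "cmod (l i ^ (r + X m) / of_real (\<mu> i j ^ X m) - l j ^ (r + X m) / of_real (\<mu> i j ^ X m))
        > cmod (w i - w j) / 2" for m
    proof -
      have mu: "\<mu> i j ^ X m > 0" using x P(1)[OF ij] by (auto simp: \<mu>_def less_max_iff_disj)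
      have "cmod (w i - w j) / 2 < cmod (l i ^ (r + X m) - l j ^ (r + X m)) / \<mu> i j ^ X m"
        using m mu by (simp add: norm_divide norm_power flip: diff_divide_distrib of_real_power)
      also have "\<dots> = cmod (l i - l j) * cmod (hom_sum (r + X m) (l i) (l j)) / \<mu> i j ^ X m"
        by (simp add: hom_sum_diff flip: norm_mult)
      finally show ?thesis using mu False by (simp add: E_def field_simps)
    qed
    then show ?thesis using ev \<open>w i - w j \<noteq> 0\<close> False
      by (intro exI[of _ ?c]) (auto elim!: eventually_mono)
  qed
  let ?ev = "\<lambda>i j c. \<forall>\<^sub>F m in sequentially. cmod (hom_sum (r + X m) (l i) (l j)) \<ge> c * (\<mu> i j ^ X m * E i j m)"
  have "\<forall>y\<in>P. \<exists>c. c > 0 \<and> ?ev (fst y) (snd y) c"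
  proof
    fix y assume "y \<in> P"
    then show "\<exists>c. c > 0 \<and> ?ev (fst y) (snd y) c" using bound[of "fst y" "snd y"] by simp
  qed
  from bchoice[OF this] obtain c' where c': "\<forall>y\<in>P. c' y > 0 \<and> ?ev (fst y) (snd y) (c' y)" by blast
  define c where "c i j = c' (i, j)" for i j
  have c: "c i j > 0" "?ev i j (c i j)" if "(i, j) \<in> P" for i j
    using c' that by (force simp: c_def)+
  define C where "C = (\<Prod>(i, j)\<in>P. c i j)"
  define R where "R = (\<Prod>(i, j)\<in>P. \<mu> i j)"
  have C: "C > 0" unfolding C_def by (rule prod_pos) (use c(1) in auto)
  have mu_pos: "\<mu> i j > 0" if "(i, j) \<in> P" for i j
    using x P(1)[OF that] by (auto simp: \<mu>_def less_max_iff_disj)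
  have upper: "\<forall>\<^sub>F m in sequentially. C * (R ^ X m * (\<Prod>(i, j)\<in>P. E i j m)) \<le> 1"
  proof -
    have "\<forall>\<^sub>F m in sequentially. \<forall>(i, j)\<in>P. cmod (hom_sum (r + X m) (l i) (l j)) \<ge> c i j * (\<mu> i j ^ X m * E i j m)"
      using c(2) finP by (auto intro!: eventually_ball_finite)
    then show ?thesis
    proof (rule eventually_mono)
      fix m assume m: "\<forall>(i, j)\<in>P. cmod (hom_sum (r + X m) (l i) (l j)) \<ge> c i j * (\<mu> i j ^ X m * E i j m)"
      have "C * (R ^ X m * (\<Prod>(i, j)\<in>P. E i j m)) = (\<Prod>(i, j)\<in>P. c i j * (\<mu> i j ^ X m * E i j m))"
        unfolding C_def R_def prod_power_distrib prod.distrib[symmetric] by (simp add: case_prod_unfold prod.distrib)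
      also have "\<dots> \<le> (\<Prod>(i, j)\<in>P. cmod (hom_sum (r + X m) (l i) (l j)))"
        using m c(1) mu_pos by (intro prod_mono) (auto simp: E_def less_imp_le)
      also have "\<dots> = cmod (\<Prod>(i, j)\<in>P. hom_sum (r + X m) (l i) (l j))"
        by (simp add: case_prod_unfold prod_norm)
      finally show "C * (R ^ X m * (\<Prod>(i, j)\<in>P. E i j m)) \<le> 1" by (simp add: one')
    qed
  qed
  have X1: "\<forall>\<^sub>F m in sequentially. X m \<ge> 1" using X by (simp add: filterlim_at_top)
  \<comment> \<open>If \<open>R > 1\<close>, then \<open>R ^ X m\<close> is unbounded while the
    product of the \<open>E i j m\<close> is eventually at least 1, contradicting
    \<open>upper\<close>.\<close>
  have R: "R \<le> 1"
  proof (rule ccontr)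
    assume "\<not> R \<le> 1"
    then have R: "R > 1" by simp
    obtain n where n: "1 / C + 1 < R ^ n" using real_arch_pow[OF R] by blast
    have "\<forall>\<^sub>F m in sequentially. X m \<ge> n" using X by (simp add: filterlim_at_top)
    then have "\<forall>\<^sub>F m in sequentially. R ^ X m \<ge> 1 / C + 1"
      by (rule eventually_mono) (use n R power_increasing[of n _ R] in \<open>meson less_imp_le order_trans\<close>)
    then have "\<forall>\<^sub>F m in sequentially. False"
      using upper X1
    proof eventually_elim
      case (elim m)
      have "(\<Prod>(i, j)\<in>P. E i j m) \<ge> 1" using elim by (intro prod_ge_1) (auto simp: E_def)
      then have "R ^ X m * 1 \<le> R ^ X m * (\<Prod>(i, j)\<in>P. E i j m)"
        using R by (intro mult_left_mono) auto
      then have "1 / C + 1 \<le> R ^ X m * (\<Prod>(i, j)\<in>P. E i j m)" using elim(1) by linarith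
      then have "C * (1 / C + 1) \<le> C * (R ^ X m * (\<Prod>(i, j)\<in>P. E i j m))"
        using C by (intro mult_left_mono) auto
      also have "\<dots> \<le> 1" by (rule elim(2))
      finally have "C * (1 / C + 1) \<le> 1" .
      then show False using C by (simp add: distrib_left)
    qed
    then show False by simp
  qed
  have eq: "x i = 1" if "i < d" for i
  proof (rule prod_max_pairs_le_1_imp_eq_1[OF x _ _ that])
    show "(\<Prod>i<d. x i) = 1" using det by (simp add: x_def)
    show "(\<Prod>i<d. \<Prod>j<i. max (x i) (x j)) \<le> 1" using R unfolding R_def \<mu>_def prodPr .
  qed
  then show "\<And>i. i < d \<Longrightarrow> cmod (l i) = 1" by (simp add: x_def)
  have R1: "R = 1"
    unfolding R_def \<mu>_def using P eq by (intro prod.neutral) auto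
  \<comment> \<open>With \<open>R = 1\<close>, a coinciding pair would contribute the unbounded
    factor \<open>X m\<close>, again contradicting \<open>upper\<close>.\<close>
  show "inj_on l {..<d}"
  proof (rule ccontr)
    assume "\<not> inj_on l {..<d}"
    then obtain i j where ij: "(i, j) \<in> P" "l i = l j"
      unfolding inj_on_def P_def by (auto simp: ) (metis linorder_neqE_nat)
    have "\<forall>\<^sub>F m in sequentially. real (X m) \<ge> 1 / C + 1"
      using filterlim_compose[OF filterlim_real_sequentially X] by (simp add: filterlim_at_top)
    then have "\<forall>\<^sub>F m in sequentially. False"
      using upper X1
    proof eventually_elim
      case (elim m)
      have "(\<Prod>(a, b)\<in>P. E a b m) = E i j m * (\<Prod>(a, b)\<in>P - {(i, j)}. E a b m)"
        using prod.remove[OF finP ij(1), of "\<lambda>(a, b). E a b m"] by simp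
      moreover have "(\<Prod>(a, b)\<in>P - {(i, j)}. E a b m) \<ge> 1"
        using elim by (intro prod_ge_1) (simp add: E_def case_prod_unfold)
      moreover have "E i j m = real (X m)" using ij by (simp add: E_def)
      ultimately have "real (X m) * 1 \<le> (\<Prod>(a, b)\<in>P. E a b m)"
        by (simp only:) (intro mult_left_mono, auto)
      then have "1 / C + 1 \<le> (\<Prod>(a, b)\<in>P. E a b m)" using elim by linarith
      then have "C * (1 / C + 1) \<le> C * (\<Prod>(a, b)\<in>P. E a b m)" using C by (intro mult_left_mono) auto
      also have "\<dots> \<le> 1" using elim by (simp add: R1)
      finally show False using C by (simp add: distrib_left)
    qed
    then show False by simp
  qed
qed

section \<open>Two-generated semidirect products\<close>

text \<open>A Nielsen move, undone by multiplying with the inverse of \<open>z\<close>.\<close>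

lemma (in group) generate_insert_mult:
  assumes x: "x \<in> carrier G" and y: "y \<in> carrier G" and z: "z \<in> generate G {y}"
  shows "generate G {x \<otimes> z, y} = generate G {x, y}"
proof (rule equalityI)
  have yc: "generate G {y} \<subseteq> carrier G" using generate_incl[of "{y}"] y by simp
  have z1: "z \<in> generate G {a, y}" for a using z mono_generate[of "{y}" "{a, y}"] by blast
  show "generate G {x \<otimes> z, y} \<subseteq> generate G {x, y}"
  proof (rule generate_subgroup_incl)
    show "{x \<otimes> z, y} \<subseteq> generate G {x, y}"
      using z1[of x] generate.incl[of x "{x, y}"] generate.incl[of y "{x, y}"] generate.eng by fastforce
  qed (use x y in \<open>auto intro: generate_is_subgroup\<close>)
  have zc: "z \<in> carrier G" using z yc by blast
  have sub: "subgroup (generate G {x \<otimes> z, y}) G"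
    using x y zc by (intro generate_is_subgroup) auto
  have "(x \<otimes> z) \<otimes> inv z \<in> generate G {x \<otimes> z, y}"
    using z1[of "x \<otimes> z"] sub generate.incl[of "x \<otimes> z" "{x \<otimes> z, y}"]
    by (meson insertI1 subgroup.m_closed subgroup.m_inv_closed)
  then have "x \<in> generate G {x \<otimes> z, y}" using x zc by (simp add: m_assoc)
  then show "generate G {x, y} \<subseteq> generate G {x \<otimes> z, y}"
    using sub generate.incl[of y "{x \<otimes> z, y}"] by (intro generate_subgroup_incl) auto
qed

text \<open>Subtractive Euclid on the values of \<open>h\<close>: Nielsen moves decrease the sum of
  their absolute values until one of them is 0.\<close>

lemma (in group) two_generators_euclid:
  fixes h :: "'a \<Rightarrow> int"
  assumes h: "\<And>x y. x \<in> carrier G \<Longrightarrow> y \<in> carrier G \<Longrightarrow> h (x \<otimes> y) = h x + h y"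
    and x: "x \<in> carrier G" and y: "y \<in> carrier G"
  shows "\<exists>s b. s \<in> carrier G \<and> b \<in> carrier G \<and> h b = 0 \<and> generate G {s, b} = generate G {x, y}"
  using x y
proof (induction "nat \<bar>h x\<bar> + nat \<bar>h y\<bar>" arbitrary: x y rule: less_induct)
  case less
  note xy = less.prems
  have one: "h \<one> = 0" using h[of \<one> \<one>] by simp
  have hinv: "h (inv a) = - h a" if "a \<in> carrier G" for a
    using h[of a "inv a"] that one by simp
  have step: "\<exists>s b. s \<in> carrier G \<and> b \<in> carrier G \<and> h b = 0 \<and> generate G {s, b} = generate G {u, v}"
    if uv: "u \<in> carrier G" "v \<in> carrier G" and m: "nat \<bar>h u\<bar> + nat \<bar>h v\<bar> = nat \<bar>h x\<bar> + nat \<bar>h y\<bar>"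
      and le: "\<bar>h v\<bar> \<le> \<bar>h u\<bar>" "h v \<noteq> 0" for u v
  proof -
    \<comment> \<open>The sign is chosen so that \<open>h w\<close> points from \<open>h u\<close>
      towards 0.\<close>
    define w where "w = (if (h u \<ge> 0) = (h v \<ge> 0) then inv v else v)"
    have w: "w \<in> generate G {v}" "w \<in> carrier G"
      using uv by (auto simp: w_def intro: generate.intros)
    have "nat \<bar>h (u \<otimes> w)\<bar> < nat \<bar>h u\<bar>"
      using le uv hinv[of v] by (auto simp: w_def h split: if_splits)
    then have "nat \<bar>h (u \<otimes> w)\<bar> + nat \<bar>h v\<bar> < nat \<bar>h x\<bar> + nat \<bar>h y\<bar>" using m by linarith
    from less.hyps[OF this m_closed[OF uv(1) w(2)] uv(2)] show ?thesis
      unfolding generate_insert_mult[OF uv w(1)] .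
  qed
  show ?case
  proof (cases "h x = 0 \<or> h y = 0")
    case True
    then show ?thesis using xy by (metis insert_commute)
  next
    case False
    show ?thesis
    proof (cases "\<bar>h y\<bar> \<le> \<bar>h x\<bar>")
      case True
      then show ?thesis using step[of x y] xy False by simp
    next
      case F: False
      then show ?thesis using step[of y x] xy False by (simp add: insert_commute add.commute)
    qed
  qed
qed

text \<open>The finite generating set \<open>S0\<close> ensures that the minimum in
  \<open>group_rank\<close> is attained. Smaller sets are padded, so \<open>x = y\<close> is
  allowed.\<close>

lemma group_rank_less_3_imp_two_generators:
  assumes G: "group G" and S0: "finite S0" "S0 \<subseteq> carrier G" "generate G S0 = carrier G"
    and rank: "group_rank G < 3"
  shows "\<exists>x y. x \<in> carrier G \<and> y \<in> carrier G \<and> generate G {x, y} = carrier G"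
proof -
  interpret group G by (rule G)
  have "\<exists>k S. S \<subseteq> carrier G \<and> finite S \<and> card S = k \<and> generate G S = carrier G"
    using S0 by blast
  from LeastI_ex[OF this] obtain S where S: "S \<subseteq> carrier G" "finite S" "card S = group_rank G"
    "generate G S = carrier G"
    unfolding group_rank_def by blast
  have "\<exists>x y. S \<subseteq> {x, y} \<and> x \<in> carrier G \<and> y \<in> carrier G"
  proof -
    consider "card S = 0" | "card S = 1" | "card S = 2" using S(3) rank by linarith
    then show ?thesis
    proof cases
      case 1
      then show ?thesis using S(2) by auto
    next
      case 2
      then obtain x where "S = {x}" by (auto simp: card_1_singleton_iff)
      then show ?thesis using S(1) by auto
    next
      case 3
      then obtain x y where "S = {x, y}" by (auto simp: card_2_iff)
      then show ?thesis using S(1) by auto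
    qed
  qed
  then obtain x y where xy: "S \<subseteq> {x, y}" "x \<in> carrier G" "y \<in> carrier G" by blast
  have "generate G S \<subseteq> generate G {x, y}" by (rule mono_generate[OF xy(1)])
  moreover have "generate G {x, y} \<subseteq> carrier G" using xy by (intro generate_incl) auto
  ultimately show ?thesis using S(4) xy by (intro exI[of _ x] exI[of _ y]) auto
qed

lemma carrier_semidirect_int: "carrier (semidirect_int A \<psi>) = carrier A \<times> UNIV"
  by (simp add: semidirect_int_def)

lemma mult_semidirect_int:
  "(a, m) \<otimes>\<^bsub>semidirect_int A \<psi>\<^esub> (b, n) = (a \<otimes>\<^bsub>A\<^esub> (\<psi> [^]\<^bsub>AutoGroup A\<^esub> m) b, m + n)"
  by (simp add: semidirect_int_def)

lemma one_semidirect_int: "\<one>\<^bsub>semidirect_int A \<psi>\<^esub> = (\<one>\<^bsub>A\<^esub>, 0)"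
  by (simp add: semidirect_int_def)

lemma group_monoid_vec: "group (monoid_vec TYPE('a :: ab_group_add) d)"
  using comm_group_vec comm_group.axioms(2) by blast

lemma mult_mat_zero_vec: "M \<in> carrier_mat n m \<Longrightarrow> M *\<^sub>v 0\<^sub>v m = 0\<^sub>v n"
  by (intro eq_vecI) auto

section \<open>Extensions of the lattice by an invertible integer matrix\<close>

text \<open>The inverse is carried as a matrix to make negative powers of the automorphism explicit;
  the n-th powers of the pair form another instance.\<close>

locale int_mat_pair =
  fixes d :: nat and A A' :: "int mat"
  assumes A [simp]: "A \<in> carrier_mat d d" and A' [simp]: "A' \<in> carrier_mat d d"
    and AA': "A * A' = 1\<^sub>m d" and A'A: "A' * A = 1\<^sub>m d"
begin

abbreviation "V \<equiv> monoid_vec TYPE(int) d"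
abbreviation "\<psi> \<equiv> mat_automorphism d A"
abbreviation "G \<equiv> semidirect_int V \<psi>"
abbreviation "pw (m :: int) \<equiv> \<psi> [^]\<^bsub>AutoGroup V\<^esub> m"

lemma psi_auto: "\<psi> \<in> auto V"
  by (rule mat_automorphism_in_auto)
    (use AA' A'A in \<open>auto simp: GL_int_def units_of_def Units_def ring_mat_simps\<close>)

sublocale G: group G
  by (rule group_semidirect_int[OF group_monoid_vec psi_auto])

lemma pw_add: "v \<in> carrier_vec d \<Longrightarrow> pw (m + n) v = pw m (pw n v)"
  and pw_0: "v \<in> carrier_vec d \<Longrightarrow> pw 0 v = v"
  and pw_1: "pw 1 = \<psi>"
proof -
  interpret Aut: group "AutoGroup V" by (rule group.AutoGroup[OF group_monoid_vec])
  have p: "pw m \<in> auto V" for m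
    using Aut.int_pow_closed[of \<psi> m] psi_auto by (simp add: AutoGroup_simps)
  show "pw (m + n) v = pw m (pw n v)" if "v \<in> carrier_vec d"
    using Aut.int_pow_mult[of \<psi> m n] psi_auto AutoGroup_simps(3)[OF p[of m] p[of n]] that
    by (simp add: AutoGroup_simps(1) compose_def monoid_vec_simps)
  show "pw 0 v = v" if "v \<in> carrier_vec d"
    using that by (simp add: AutoGroup_simps monoid_vec_simps)
  show "pw 1 = \<psi>" using Aut.int_pow_1[of \<psi>] psi_auto by (simp add: AutoGroup_simps(1))
qed

lemma pw_1_apply: "v \<in> carrier_vec d \<Longrightarrow> pw 1 v = A *\<^sub>v v"
  unfolding pw_1 by (simp add: mat_automorphism_def)

lemma pw_minus_1_apply:
  assumes v: "v \<in> carrier_vec d"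
  shows "pw (- 1) v = A' *\<^sub>v v"
proof -
  have A'v: "A' *\<^sub>v v \<in> carrier_vec d" using v by (rule mult_mat_vec_carrier[OF A'])
  have "pw 1 (A' *\<^sub>v v) = (A * A') *\<^sub>v v"
    using A'v v by (simp add: pw_1_apply assoc_mult_mat_vec[of A d d A' d])
  also have "\<dots> = v" using v by (simp add: AA')
  finally have "pw (- 1) v = pw (- 1) (pw 1 (A' *\<^sub>v v))" by simp
  also have "\<dots> = A' *\<^sub>v v" using pw_add[OF A'v, of "- 1" 1] pw_0[OF A'v] by simp
  finally show ?thesis .
qed

lemma pw_closed_set:
  assumes L: "L \<subseteq> carrier_vec d" "\<And>v. v \<in> L \<Longrightarrow> A *\<^sub>v v \<in> L" "\<And>v. v \<in> L \<Longrightarrow> A' *\<^sub>v v \<in> L"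
  shows "v \<in> L \<Longrightarrow> pw m v \<in> L"
proof (induction m arbitrary: v rule: int_induct[of _ 0])
  case base
  then show ?case using L(1) pw_0 by auto
next
  case (step1 m)
  then have "pw (m + 1) v = pw m (A *\<^sub>v v)"
    using L(1) pw_add[of v m 1] pw_1_apply[of v] by auto
  then show ?case using step1 L by simp
next
  case (step2 m)
  then have "pw (m - 1) v = pw m (A' *\<^sub>v v)"
    using L(1) pw_add[of v m "- 1"] pw_minus_1_apply[of v] by auto
  then show ?case using step2 L by simp
qed

text \<open>Every generated element has the form v s^k with v in \<open>L\<close>, because
  conjugation by \<open>s\<close> preserves \<open>L\<close>. As the whole group is reached,
  \<open>s\<close> has nonzero t-exponent; so a vector, having t-exponent 0, has k = 0 and lies in
  \<open>L\<close>.\<close>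

lemma generated_kernel_part:
  assumes s: "s \<in> carrier G" and b: "b \<in> carrier_vec d"
    and L: "L \<subseteq> carrier_vec d" "\<And>v. v \<in> L \<Longrightarrow> A *\<^sub>v v \<in> L" "\<And>v. v \<in> L \<Longrightarrow> A' *\<^sub>v v \<in> L"
    and bL: "b \<in> L" and L0: "0\<^sub>v d \<in> L"
    and Ladd: "\<And>v w. v \<in> L \<Longrightarrow> w \<in> L \<Longrightarrow> v + w \<in> L" and Lneg: "\<And>v. v \<in> L \<Longrightarrow> - v \<in> L"
    and gen: "generate G {s, (b, 0)} = carrier G"
  shows "L = carrier_vec d"
proof -
  have inG: "(v, m) \<in> carrier G" if "v \<in> carrier_vec d" for v m
    using that by (simp add: carrier_semidirect_int monoid_vec_simps)
  have mult: "(v, m) \<otimes>\<^bsub>G\<^esub> (w, n) = (v + pw m w, m + n)" for v w m n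
    by (simp add: mult_semidirect_int monoid_vec_simps)
  have G_one: "\<one>\<^bsub>G\<^esub> = (0\<^sub>v d, 0)" by (simp add: one_semidirect_int monoid_vec_simps)
  have pw_one: "\<one>\<^bsub>AutoGroup V\<^esub> v = v" if "v \<in> carrier_vec d" for v
    using that by (simp add: AutoGroup_simps(2) monoid_vec_simps)
  have spow: "s [^]\<^bsub>G\<^esub> (k :: int) \<in> carrier G" for k using s by (rule G.int_pow_closed)
  have pow_form: "\<exists>u\<in>carrier_vec d. s [^]\<^bsub>G\<^esub> (k :: int) = (u, k * snd s)" for k
  proof -
    have snd_mult: "snd (x \<otimes>\<^bsub>G\<^esub> y) = snd x + snd y" for x y
      by (cases x; cases y) (simp add: mult)
    have "snd (s [^]\<^bsub>G\<^esub> k) = k * snd s"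
    proof (induction k rule: int_induct[of _ 0])
      case base
      then show ?case by (simp add: G_one)
    next
      case (step1 k)
      then show ?case using s
        by (simp add: G.int_pow_mult G.int_pow_1 snd_mult distrib_right)
    next
      case (step2 k)
      have "s [^]\<^bsub>G\<^esub> k = s [^]\<^bsub>G\<^esub> (k - 1) \<otimes>\<^bsub>G\<^esub> s"
        using G.int_pow_mult[OF s, of "k - 1" 1] s by (simp add: G.int_pow_1)
      then show ?case using step2
        by (simp add: snd_mult left_diff_distrib)
    qed
    then show ?thesis using spow[of k]
      by (intro bexI[of _ "fst (s [^]\<^bsub>G\<^esub> k)"])
        (auto simp: carrier_semidirect_int monoid_vec_simps prod_eq_iff mem_Times_iff)
  qed
  have form: "\<exists>k :: int. \<exists>v\<in>L. x = (v, 0) \<otimes>\<^bsub>G\<^esub> s [^]\<^bsub>G\<^esub> k" if "x \<in> generate G {s, (b, 0)}" for x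
    using that
  proof (induction rule: generate.induct)
    case one
    have "(0\<^sub>v d, 0) \<otimes>\<^bsub>G\<^esub> s [^]\<^bsub>G\<^esub> (0 :: int) = \<one>\<^bsub>G\<^esub>"
      by (simp flip: G_one)
    then show ?case using L0 by metis
  next
    case (incl x)
    then consider "x = s" | "x = (b, 0)" by auto
    then show ?case
    proof cases
      case 1
      have "(0\<^sub>v d, 0) \<otimes>\<^bsub>G\<^esub> s [^]\<^bsub>G\<^esub> (1 :: int) = s"
        using s by (simp add: G.int_pow_1 flip: G_one)
      then show ?thesis using 1 L0 by metis
    next
      case 2
      have "(b, 0) \<otimes>\<^bsub>G\<^esub> s [^]\<^bsub>G\<^esub> (0 :: int) = (b, 0)"
        using inG[OF b, of 0] by simp
      then show ?thesis using 2 bL by metis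
    qed
  next
    case (inv x)
    then consider "x = s" | "x = (b, 0)" by auto
    then show ?case
    proof cases
      case 1
      have "(0\<^sub>v d, 0) \<otimes>\<^bsub>G\<^esub> s [^]\<^bsub>G\<^esub> (- 1 :: int) = inv\<^bsub>G\<^esub> s"
        using s by (simp add: G.int_pow_neg G.int_pow_1 flip: G_one)
      then show ?thesis using 1 L0 by metis
    next
      case 2
      have "(- b, 0) \<otimes>\<^bsub>G\<^esub> (b, 0) = \<one>\<^bsub>G\<^esub>"
        using b by (simp add: mult pw_one G_one)
      then have "inv\<^bsub>G\<^esub> (b, 0) = (- b, 0)"
        using b by (intro G.inv_equality inG) auto
      moreover have "(- b, 0) \<otimes>\<^bsub>G\<^esub> s [^]\<^bsub>G\<^esub> (0 :: int) = (- b, 0)"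
        using inG[of "- b" 0] b by simp
      ultimately show ?thesis using 2 Lneg[OF bL] by metis
    qed
  next
    case (eng x y)
    then obtain k v k' v' where x: "x = (v, 0) \<otimes>\<^bsub>G\<^esub> s [^]\<^bsub>G\<^esub> (k :: int)" "v \<in> L"
      and y: "y = (v', 0) \<otimes>\<^bsub>G\<^esub> s [^]\<^bsub>G\<^esub> (k' :: int)" "v' \<in> L" by blast
    obtain u where u: "u \<in> carrier_vec d" "s [^]\<^bsub>G\<^esub> k = (u, k * snd s)" using pow_form by blast
    define w where "w = pw (k * snd s) v'"
    have w: "w \<in> L" unfolding w_def by (rule pw_closed_set[OF L y(2)])
    have c: "v \<in> carrier_vec d" "v' \<in> carrier_vec d" "w \<in> carrier_vec d" using x y w L(1) by auto
    \<comment> \<open>The vector part of s^k commutes with vectors, so conjugation by s^k acts on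
      them as a mere power of the automorphism.\<close>
    have swap: "s [^]\<^bsub>G\<^esub> k \<otimes>\<^bsub>G\<^esub> (v', 0) = (w, 0) \<otimes>\<^bsub>G\<^esub> s [^]\<^bsub>G\<^esub> k"
      unfolding u mult using u c by (simp add: w_def pw_one comm_add_vec[of _ d])
    have "x \<otimes>\<^bsub>G\<^esub> y = (v, 0) \<otimes>\<^bsub>G\<^esub> ((s [^]\<^bsub>G\<^esub> k \<otimes>\<^bsub>G\<^esub> (v', 0)) \<otimes>\<^bsub>G\<^esub> s [^]\<^bsub>G\<^esub> k')"
      unfolding x y using inG[of v 0] inG[of v' 0] c spow by (simp add: G.m_assoc)
    also have "\<dots> = ((v, 0) \<otimes>\<^bsub>G\<^esub> (w, 0)) \<otimes>\<^bsub>G\<^esub> (s [^]\<^bsub>G\<^esub> k \<otimes>\<^bsub>G\<^esub> s [^]\<^bsub>G\<^esub> k')"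
      unfolding swap using inG[of v 0] inG[of w 0] c spow by (simp add: G.m_assoc)
    also have "(v, 0) \<otimes>\<^bsub>G\<^esub> (w, 0) = (v + w, 0)" using c by (simp add: mult pw_one)
    also have "s [^]\<^bsub>G\<^esub> k \<otimes>\<^bsub>G\<^esub> s [^]\<^bsub>G\<^esub> k' = s [^]\<^bsub>G\<^esub> (k + k')"
      using s by (simp add: G.int_pow_mult)
    finally show ?case using Ladd[OF x(2) w] by blast
  qed
  have form': "\<exists>k :: int. \<exists>v\<in>L. \<exists>u\<in>carrier_vec d. s [^]\<^bsub>G\<^esub> k = (u, k * snd s) \<and> x = v + u \<and> m = k * snd s"
    if x: "x \<in> carrier_vec d" for x m
  proof -
    obtain k v where v: "v \<in> L" "(x, m) = (v, 0) \<otimes>\<^bsub>G\<^esub> s [^]\<^bsub>G\<^esub> (k :: int)"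
      using form[of "(x, m)"] inG[OF x] gen by blast
    obtain u where u: "u \<in> carrier_vec d" "s [^]\<^bsub>G\<^esub> k = (u, k * snd s)" using pow_form by blast
    show ?thesis using v u by (auto simp: mult pw_one)
  qed
  \<comment> \<open>Otherwise the element with t-exponent 1 would not be reached.\<close>
  have nz: "snd s \<noteq> 0" using form'[of "0\<^sub>v d" 1] by auto
  have "x \<in> L" if x: "x \<in> carrier_vec d" for x
  proof -
    obtain k v u where v: "v \<in> L" "s [^]\<^bsub>G\<^esub> (k :: int) = (u, k * snd s)" "x = v + u" "k * snd s = 0"
      using form'[OF x, of 0] by metis
    then have "k = 0" using nz by simp
    then have "u = 0\<^sub>v d" using v(2) by (simp add: G_one)
    then show ?thesis using v L(1) by auto
  qed
  then show ?thesis using L(1) by auto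
qed

text \<open>Needed to give \<open>group_rank\<close> its meaning; t and the unit vectors
  generate.\<close>

lemma finite_generating_set:
  shows "\<exists>S. finite S \<and> S \<subseteq> carrier G \<and> generate G S = carrier G"
proof -
  define S where "S = insert (0\<^sub>v d, 1) ((\<lambda>i. (unit_vec d i :: int vec, 0 :: int)) ` {..<d})"
  have Sc: "S \<subseteq> carrier G" by (auto simp: S_def carrier_semidirect_int monoid_vec_simps)
  have mult: "(v, m) \<otimes>\<^bsub>G\<^esub> (w, n) = (v + pw m w, m + n)" for v w m n
    by (simp add: mult_semidirect_int monoid_vec_simps)
  have G_one: "\<one>\<^bsub>G\<^esub> = (0\<^sub>v d, 0)" by (simp add: one_semidirect_int monoid_vec_simps)
  have pw_zero: "pw m (0\<^sub>v d) = 0\<^sub>v d" for m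
    using pw_closed_set[of "{0\<^sub>v d}" "0\<^sub>v d" m] by (simp add: mult_mat_zero_vec[OF A] mult_mat_zero_vec[OF A'])
  have mult0: "(v, m) \<otimes>\<^bsub>G\<^esub> (0\<^sub>v d, n) = (v, m + n)" if "v \<in> carrier_vec d" for v m n
    using that by (simp add: mult pw_zero)
  have mult0': "(v, 0) \<otimes>\<^bsub>G\<^esub> (w, n) = (v + w, n)" if "w \<in> carrier_vec d" for v w n
    unfolding mult pw_0[OF that] by simp
  interpret H: subgroup "generate G S" G by (rule G.generate_is_subgroup[OF Sc])
  have t: "(0\<^sub>v d, 1) \<in> generate G S" by (rule generate.incl) (simp add: S_def)
  have t': "(0\<^sub>v d, - 1) \<in> generate G S"
  proof -
    have "inv\<^bsub>G\<^esub> (0\<^sub>v d, 1) = (0\<^sub>v d, - 1)"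
      by (rule G.inv_equality) (auto simp: mult0 G_one carrier_semidirect_int monoid_vec_simps)
    then show ?thesis using H.m_inv_closed[OF t] by simp
  qed
  have tm: "(0\<^sub>v d, m) \<in> generate G S" for m
  proof (induction m rule: int_induct[of _ 0])
    case base
    then show ?case using H.one_closed by (simp add: G_one)
  next
    case (step1 m)
    then show ?case using H.m_closed[OF step1(2) t] by (simp add: mult0)
  next
    case (step2 m)
    then show ?case using H.m_closed[OF step2(2) t'] by (simp add: mult0)
  qed
  have unit: "(n \<cdot>\<^sub>v unit_vec d i, 0) \<in> generate G S" if i: "i < d" for i n
  proof -
    have e: "(unit_vec d i, 0) \<in> generate G S" using i by (intro generate.incl) (simp add: S_def)
    have "inv\<^bsub>G\<^esub> (unit_vec d i, 0) = (- unit_vec d i, 0)"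
      by (rule G.inv_equality) (auto simp: mult0' G_one carrier_semidirect_int monoid_vec_simps)
    then have e': "(- unit_vec d i, 0) \<in> generate G S" using H.m_inv_closed[OF e] by simp
    show ?thesis
    proof (induction n rule: int_induct[of _ 0])
      case base
      have "0 \<cdot>\<^sub>v unit_vec d i = (0\<^sub>v d :: int vec)" by (intro eq_vecI) auto
      then show ?case using H.one_closed by (simp add: G_one)
    next
      case (step1 n)
      have "(n + 1) \<cdot>\<^sub>v unit_vec d i = n \<cdot>\<^sub>v unit_vec d i + unit_vec d i"
        by (intro eq_vecI) (auto simp: algebra_simps)
      then show ?case using H.m_closed[OF step1(2) e] by (simp add: mult0')
    next
      case (step2 n)
      have "(n - 1) \<cdot>\<^sub>v unit_vec d i = n \<cdot>\<^sub>v unit_vec d i + - unit_vec d i"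
        by (intro eq_vecI) (auto simp: algebra_simps)
      then show ?case using H.m_closed[OF step2(2) e'] by (simp add: mult0')
    qed
  qed
  have vec: "(v, 0) \<in> generate G S" if v: "v \<in> carrier_vec d" for v
  proof -
    let ?t = "\<lambda>k. vec d (\<lambda>i. if i < k then v $ i else 0)"
    have "k \<le> d \<Longrightarrow> (?t k, 0) \<in> generate G S" for k
    proof (induction k)
      case 0
      have "?t 0 = 0\<^sub>v d" by (intro eq_vecI) auto
      then show ?case using H.one_closed by (simp add: G_one)
    next
      case (Suc k)
      have "?t (Suc k) = ?t k + v $ k \<cdot>\<^sub>v unit_vec d k"
        using Suc.prems by (intro eq_vecI) (auto simp: less_Suc_eq)
      then show ?case using H.m_closed[OF Suc.IH unit[of k "v $ k"]] Suc.prems by (simp add: mult0')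
    qed
    moreover have "?t d = v" using v by (intro eq_vecI) auto
    ultimately show ?thesis by force
  qed
  have "carrier G \<subseteq> generate G S"
  proof
    fix x assume "x \<in> carrier G"
    then obtain v m where x: "x = (v, m)" "v \<in> carrier_vec d"
      by (auto simp: carrier_semidirect_int monoid_vec_simps)
    then show "x \<in> generate G S" using H.m_closed[OF vec[OF x(2)] tm[of m]] by (simp add: mult0)
  qed
  then show ?thesis
    using Sc H.subset by (intro exI[of _ S]) (auto simp: S_def)
qed

text \<open>Two generators become \<open>s\<close> and a vector \<open>b\<close>. The smallest
  subgroup of Z^d containing \<open>b\<close> and stable under \<open>A\<close> and
  \<open>A'\<close> is then everything; finitely many unit vectors require only one bounded power of
  \<open>A'\<close>, so \<open>?K\<close> is invertible over the integers.\<close>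

theorem small_rank_imp_unimodular_krylov:
  assumes d: "d > 0" and rank: "group_rank G < 3"
  shows "\<exists>b\<in>carrier_vec d. \<bar>det (krylov d A b)\<bar> = 1"
proof -
  obtain x y where xy: "x \<in> carrier G" "y \<in> carrier G" "generate G {x, y} = carrier G"
  proof -
    obtain S where S: "finite S" "S \<subseteq> carrier G" "generate G S = carrier G"
      using finite_generating_set by blast
    show thesis
      using group_rank_less_3_imp_two_generators[OF G.is_group S rank] that by blast
  qed
  have snd_mult: "snd (x \<otimes>\<^bsub>G\<^esub> y) = snd x + snd y" for x y
    by (cases x; cases y) (simp add: mult_semidirect_int)
  \<comment> \<open>The additive function given to Euclid's algorithm is the t-exponent.\<close>
  obtain s z where sz: "s \<in> carrier G" "z \<in> carrier G" "snd z = 0" "generate G {s, z} = carrier G"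
    using G.two_generators_euclid[OF snd_mult xy(1,2), unfolded xy(3)] by (elim exE conjE)
  define b where "b = fst z"
  have b: "b \<in> carrier_vec d" and z: "z = (b, 0)"
    using sz by (auto simp: b_def carrier_semidirect_int monoid_vec_simps)
  let ?K = "krylov d A b"
  obtain C where C: "C \<in> carrier_mat d d" "A * ?K = ?K * C"
    using krylov_companion[OF A b] by blast
  let ?f = "\<lambda>j u. A' ^\<^sub>m j *\<^sub>v (?K *\<^sub>v u)"
  note mv = mult_mat_vec_carrier[of _ d d]
  have Kc: "?K *\<^sub>v u \<in> carrier_vec d" if "u \<in> carrier_vec d" for u
    using that by (rule mv[OF krylov_carrier])
  have A'p: "A' ^\<^sub>m j \<in> carrier_mat d d" for j by simp
  have fc: "?f j u \<in> carrier_vec d" if "u \<in> carrier_vec d" for j u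
    using mv[OF A'p Kc[OF that]] .
  have AK: "A *\<^sub>v (?K *\<^sub>v u) = ?K *\<^sub>v (C *\<^sub>v u)" if "u \<in> carrier_vec d" for u
    using that assoc_mult_mat_vec[OF A krylov_carrier that] assoc_mult_mat_vec[OF krylov_carrier C(1) that] C(2)
    by metis
  have Af: "A *\<^sub>v ?f j u = ?f j (C *\<^sub>v u)" if u: "u \<in> carrier_vec d" for j u
  proof -
    have "A *\<^sub>v ?f j u = (A * A' ^\<^sub>m j) *\<^sub>v (?K *\<^sub>v u)"
      by (rule assoc_mult_mat_vec[OF A A'p Kc[OF u], symmetric])
    also have "A * A' ^\<^sub>m j = A' ^\<^sub>m j * A"
      by (rule commute_pow_mat[OF A A']) (simp add: AA' A'A)
    also have "\<dots> *\<^sub>v (?K *\<^sub>v u) = A' ^\<^sub>m j *\<^sub>v (A *\<^sub>v (?K *\<^sub>v u))"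
      by (rule assoc_mult_mat_vec[OF A'p A Kc[OF u]])
    finally show ?thesis unfolding AK[OF u] .
  qed
  have A'f: "A' *\<^sub>v ?f j u = ?f (Suc j) u" if u: "u \<in> carrier_vec d" for j u
    unfolding pow_mat_Suc_left[OF A'] by (rule assoc_mult_mat_vec[OF A' A'p Kc[OF u], symmetric])
  \<comment> \<open>Inserting \<open>A' * A\<close> and pulling \<open>A\<close> through
    \<open>?K\<close> as \<open>C\<close> raises the index, so the lattices below increase with
    j.\<close>
  have lift: "\<exists>w\<in>carrier_vec d. ?f j u = ?f (j + m) w" if u: "u \<in> carrier_vec d" for j u m
  proof (induction m)
    case 0
    then show ?case using u by auto
  next
    case (Suc m)
    then obtain w where w: "w \<in> carrier_vec d" "?f j u = ?f (j + m) w" by blast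
    have "?f (j + m) w = (A' * A) *\<^sub>v ?f (j + m) w" using fc[OF w(1)] by (simp add: A'A)
    also have "\<dots> = A' *\<^sub>v (A *\<^sub>v ?f (j + m) w)"
      by (rule assoc_mult_mat_vec[OF A' A fc[OF w(1)]])
    also have "\<dots> = ?f (Suc (j + m)) (C *\<^sub>v w)"
      unfolding Af[OF w(1)] by (rule A'f[OF mv[OF C(1) w(1)]])
    finally show ?case using w mv[OF C(1) w(1)] by (intro bexI[of _ "C *\<^sub>v w"]) auto
  qed
  \<comment> \<open>the increasing union of the lattices \<^verbatim>\<open>A^(-j) K Z^d\<close>, stable under \<^verbatim>\<open>A\<close> by Cayley--Hamilton\<close>
  define L where "L = {?f j u | j u. u \<in> carrier_vec d}"
  have L: "L = carrier_vec d"
  proof (rule generated_kernel_part[OF sz(1) b])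
    show "L \<subseteq> carrier_vec d" using fc by (auto simp: L_def)
    show "A *\<^sub>v v \<in> L" "A' *\<^sub>v v \<in> L" if "v \<in> L" for v
      using that Af A'f mv[OF C(1)] unfolding L_def by blast+
    have "?K *\<^sub>v unit_vec d 0 = b"
    proof (rule eq_vecI)
      fix i assume "i < dim_vec b"
      then have i: "i < d" using b by simp
      then have "(?K *\<^sub>v unit_vec d 0) $ i = ?K $$ (i, 0)"
        using d by (simp add: krylov_def)
      then show "(?K *\<^sub>v unit_vec d 0) $ i = b $ i"
        using i d b carrier_matD(1)[OF A] by (simp add: krylov_def)
    qed (use b in \<open>simp add: krylov_def\<close>)
    then have "b = ?f 0 (unit_vec d 0)" using b carrier_matD(1)[OF A'] by simp
    then show "b \<in> L" unfolding L_def by (metis (mono_tags, lifting) mem_Collect_eq unit_vec_carrier)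
    have "0\<^sub>v d = ?f 0 (0\<^sub>v d)" using carrier_matD(1)[OF A'] by (simp add: mult_mat_zero_vec[OF krylov_carrier])
    then show "0\<^sub>v d \<in> L" unfolding L_def by (metis (mono_tags, lifting) mem_Collect_eq zero_carrier_vec)
    show "v + w \<in> L" if vwL: "v \<in> L" "w \<in> L" for v w
    proof -
      obtain j u i u' where vw: "v = ?f j u" "u \<in> carrier_vec d" "w = ?f i u'" "u' \<in> carrier_vec d"
        using vwL unfolding L_def by blast
      obtain u1 where u1: "u1 \<in> carrier_vec d" "v = ?f (j + i) u1"
        using lift[OF vw(2), of j i] vw(1) by auto
      obtain u2 where u2: "u2 \<in> carrier_vec d" "w = ?f (j + i) u2"
        using lift[OF vw(4), of i j] vw(3) by (auto simp: add.commute)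
      have "v + w = ?f (j + i) (u1 + u2)"
        unfolding u1(2) u2(2) mult_add_distrib_mat_vec[OF krylov_carrier u1(1) u2(1)]
        by (rule mult_add_distrib_mat_vec[OF A'p Kc[OF u1(1)] Kc[OF u2(1)], symmetric])
      moreover have "u1 + u2 \<in> carrier_vec d" using u1 u2 by simp
      ultimately show ?thesis unfolding L_def by blast
    qed
    show "- v \<in> L" if vL: "v \<in> L" for v
    proof -
      obtain j u where v: "v = ?f j u" "u \<in> carrier_vec d" using vL unfolding L_def by blast
      have neg: "M *\<^sub>v - w = - (M *\<^sub>v w)" if "M \<in> carrier_mat d d" "w \<in> carrier_vec d" for M :: "int mat" and w
        using that by (intro eq_vecI) auto
      have "- v = ?f j (- u)"
        unfolding v(1) neg[OF krylov_carrier v(2)] neg[OF A'p Kc[OF v(2)]] ..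
      then show ?thesis using v(2) unfolding L_def by (metis (mono_tags, lifting) mem_Collect_eq uminus_carrier_vec)
    qed
    show "generate G {s, (b, 0)} = carrier G" using sz z by simp
  qed
  have "\<forall>i. \<exists>j u. u \<in> carrier_vec d \<and> unit_vec d i = ?f j u"
    using L unit_vec_carrier[of d] unfolding L_def by blast
  then obtain j u where ju: "\<And>i. u i \<in> carrier_vec d" "\<And>i. unit_vec d i = ?f (j i) (u i)" by metis
  \<comment> \<open>Any common upper bound of the indices \<open>j i\<close> would do.\<close>
  define J where "J = (\<Sum>i<d. j i)"
  have "\<exists>w\<in>carrier_vec d. unit_vec d i = ?f J w" if "i < d" for i
  proof -
    have "j i \<le> J" unfolding J_def using that by (intro member_le_sum) auto
    then show ?thesis using lift[OF ju(1), of "j i" i "J - j i"] ju(2)[of i] by simp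
  qed
  then obtain w where w: "\<And>i. i < d \<Longrightarrow> w i \<in> carrier_vec d" "\<And>i. i < d \<Longrightarrow> unit_vec d i = ?f J (w i)"
    by metis
  define U where "U = mat d d (\<lambda>(a, i). w i $ a)"
  have U: "U \<in> carrier_mat d d" by (simp add: U_def)
  have colU: "col U i = w i" if "i < d" for i
    using that w(1)[OF that] by (intro eq_vecI) (auto simp: U_def)
  have "A' ^\<^sub>m J * ?K * U = 1\<^sub>m d"
  proof (rule mat_col_eqI)
    fix i assume "i < dim_col (1\<^sub>m d :: int mat)"
    then have i: "i < d" by simp
    have "col (A' ^\<^sub>m J * ?K * U) i = (A' ^\<^sub>m J * ?K) *\<^sub>v col U i"
      by (rule col_mult2[OF mult_carrier_mat[OF A'p krylov_carrier] U i])
    also have "\<dots> = ?f J (w i)"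
      unfolding colU[OF i] by (rule assoc_mult_mat_vec[OF A'p krylov_carrier w(1)[OF i]])
    finally show "col (A' ^\<^sub>m J * ?K * U) i = col (1\<^sub>m d) i"
      using w(2)[OF i] i by simp
  qed (use U carrier_matD(1)[OF A'p] in auto)
  then have "1 = det (A' ^\<^sub>m J * ?K * U)" by simp
  also have "\<dots> = det (A' ^\<^sub>m J * ?K) * det U"
    by (rule det_mult[OF mult_carrier_mat[OF A'p krylov_carrier] U])
  also have "\<dots> = det ?K * (det (A' ^\<^sub>m J) * det U)"
    unfolding det_mult[OF A'p krylov_carrier] by simp
  finally have "det ?K dvd 1" by (rule dvdI)
  then show ?thesis using b by auto
qed

end

section \<open>Powers of a matrix with unimodular Krylov matrices\<close>

text \<open>For M = 1 + q B the difference M^(k+1) - M^k is q M^k B, so each differencing yields a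
  factor \<open>q\<close> and applies \<open>B\<close> once more to the vector.\<close>

lemma fwd_diff_pow_mat_entry:
  fixes B :: "int mat"
  assumes B: "B \<in> carrier_mat d d" and c: "c \<in> carrier_vec d" and i: "i < d"
  shows "(fwd_diff ^^ m) (\<lambda>k. ((1\<^sub>m d + q \<cdot>\<^sub>m B) ^\<^sub>m k *\<^sub>v c) $ i)
    = (\<lambda>k. q ^ m * ((1\<^sub>m d + q \<cdot>\<^sub>m B) ^\<^sub>m k *\<^sub>v (B ^\<^sub>m m *\<^sub>v c)) $ i)"
proof (induction m)
  case 0
  then show ?case using B c by simp
next
  case (Suc m)
  let ?M = "1\<^sub>m d + q \<cdot>\<^sub>m B" and ?v = "B ^\<^sub>m m *\<^sub>v c"
  have M: "?M \<in> carrier_mat d d" using B by simp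
  have v: "?v \<in> carrier_vec d" by (rule mult_mat_vec_carrier[OF pow_carrier_mat[OF B] c])
  have Bv: "B *\<^sub>v ?v \<in> carrier_vec d" by (rule mult_mat_vec_carrier[OF B v])
  have "(?M ^\<^sub>m Suc k *\<^sub>v ?v) $ i = (?M ^\<^sub>m k *\<^sub>v ?v) $ i + q * (?M ^\<^sub>m k *\<^sub>v (B *\<^sub>v ?v)) $ i" for k
  proof -
    have Mk: "?M ^\<^sub>m k \<in> carrier_mat d d" by (rule pow_carrier_mat[OF M])
    have "?M ^\<^sub>m Suc k *\<^sub>v ?v = ?M ^\<^sub>m k *\<^sub>v (?M *\<^sub>v ?v)"
      unfolding pow_mat.simps by (rule assoc_mult_mat_vec[OF Mk M v])
    also have "?M *\<^sub>v ?v = ?v + q \<cdot>\<^sub>v (B *\<^sub>v ?v)"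
      using B v by (simp add: add_mult_distrib_mat_vec[of _ d d] smult_mat_mult_vec[OF B v])
    also have "?M ^\<^sub>m k *\<^sub>v (?v + q \<cdot>\<^sub>v (B *\<^sub>v ?v)) = ?M ^\<^sub>m k *\<^sub>v ?v + q \<cdot>\<^sub>v (?M ^\<^sub>m k *\<^sub>v (B *\<^sub>v ?v))"
      using Bv by (simp add: mult_add_distrib_mat_vec[OF Mk v] mult_mat_smult_vec[OF Mk Bv])
    finally show ?thesis using i carrier_matD[OF Mk] by (simp del: index_mult_mat_vec)
  qed
  moreover have "B ^\<^sub>m Suc m *\<^sub>v c = B *\<^sub>v ?v"
    unfolding pow_mat_Suc_left[OF B] by (rule assoc_mult_mat_vec[OF B pow_carrier_mat[OF B] c])
  ultimately show ?case
    unfolding funpow.simps o_apply Suc unfolding fwd_diff_def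
    by (intro ext) (simp del: index_mult_mat_vec pow_mat.simps add: algebra_simps)
qed

lemma diff_div_pow_mat_entry:
  fixes B :: "int mat"
  assumes "B \<in> carrier_mat d d" "c \<in> carrier_vec d" "i < d"
  shows "diff_div q 0 (\<lambda>k. ((1\<^sub>m d + q \<cdot>\<^sub>m B) ^\<^sub>m k *\<^sub>v c) $ i)"
  unfolding diff_div_def fwd_diff_pow_mat_entry[OF assms] by simp

lemma pow_mat_one_plus:
  fixes B :: "int mat"
  assumes B: "B \<in> carrier_mat d d"
  shows "\<exists>B'\<in>carrier_mat d d. (1\<^sub>m d + q \<cdot>\<^sub>m B) ^\<^sub>m j = 1\<^sub>m d + q \<cdot>\<^sub>m B'"
proof (induction j)
  case 0
  have "1\<^sub>m d = 1\<^sub>m d + q \<cdot>\<^sub>m 0\<^sub>m d d" by (intro eq_matI) auto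
  then show ?case using B by (intro bexI[of _ "0\<^sub>m d d"]) auto
next
  case (Suc j)
  let ?M = "1\<^sub>m d + q \<cdot>\<^sub>m B"
  obtain B' where B': "B' \<in> carrier_mat d d" "?M ^\<^sub>m j = 1\<^sub>m d + q \<cdot>\<^sub>m B'"
    using Suc by blast
  have M: "?M \<in> carrier_mat d d" using B by simp
  have "?M ^\<^sub>m Suc j = 1\<^sub>m d * ?M + q \<cdot>\<^sub>m B' * ?M"
    unfolding pow_mat.simps B'(2) using B' B by (intro add_mult_distrib_mat[of _ d d]) auto
  also have "\<dots> = 1\<^sub>m d + q \<cdot>\<^sub>m (B + B' * ?M)"
    using B B' M mult_smult_assoc_mat[OF B'(1) M, of q] mult_carrier_mat[OF B'(1) M]
    by (intro eq_matI) (auto simp: algebra_simps simp del: index_mult_mat(1))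
  finally show ?case using B B' M by (intro bexI[of _ "B + B' * ?M"]) auto
qed

text \<open>Turns unimodularity into the vanishing of an expression in sums and products;
  \<open>+ - 1\<close> matches \<open>diff_div_add\<close> and
  \<open>diff_div_const\<close>.\<close>

lemma int_abs_eq_1_iff: "\<bar>x\<bar> = 1 \<longleftrightarrow> x * x + - 1 = (0 :: int)"
proof
  assume "x * x + - 1 = 0"
  then have "x * x = 1" by simp
  then show "\<bar>x\<bar> = 1" by (auto simp: zmult_eq_1_iff)
next
  assume "\<bar>x\<bar> = 1"
  then have "x = 1 \<or> x = - 1" by linarith
  then show "x * x + - 1 = 0" by auto
qed

lemma finite_bounded_mats:
  assumes "finite X"
  shows "finite {M \<in> carrier_mat n m. \<forall>i<n. \<forall>j<m. M $$ (i, j) \<in> X}"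
proof (rule finite_subset)
  show "{M \<in> carrier_mat n m. \<forall>i<n. \<forall>j<m. M $$ (i, j) \<in> X}
    \<subseteq> mat n m ` (PiE ({..<n} \<times> {..<m}) (\<lambda>_. X))"
  proof
    fix M assume M: "M \<in> {M \<in> carrier_mat n m. \<forall>i<n. \<forall>j<m. M $$ (i, j) \<in> X}"
    have "M = mat n m (restrict (($$) M) ({..<n} \<times> {..<m}))"
      using M by (intro eq_matI) auto
    moreover have "restrict (($$) M) ({..<n} \<times> {..<m}) \<in> PiE ({..<n} \<times> {..<m}) (\<lambda>_. X)"
      using M by auto
    ultimately show "M \<in> mat n m ` (PiE ({..<n} \<times> {..<m}) (\<lambda>_. X))" by blast
  qed
  show "finite (mat n m ` (PiE ({..<n} \<times> {..<m}) (\<lambda>_. X)))"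
    using assms by (intro finite_imageI finite_PiE) auto
qed

lemma finite_range_imp_repetition:
  fixes f :: "nat \<Rightarrow> 'a"
  assumes "finite S" "range f \<subseteq> S"
  obtains a b where "a < b" "f a = f b"
proof -
  have "\<not> inj f" using assms by (meson finite_imageD finite_subset infinite_UNIV_nat)
  then obtain a b where "a \<noteq> b" "f a = f b" by (auto simp: inj_def)
  then show thesis using that by (metis linorder_neqE_nat)
qed

section \<open>From infinitely many unimodular determinants to finite order\<close>

context int_mat_pair
begin

lemma pow_inverse: "A' ^\<^sub>m n * A ^\<^sub>m n = 1\<^sub>m d"
proof (induction n)
  case 0
  show ?case using carrier_matD(1)[OF A] carrier_matD(1)[OF A'] by simp
next
  case (Suc n)
  note c = pow_carrier_mat[OF A'] pow_carrier_mat[OF A]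
  have "A' ^\<^sub>m Suc n * A ^\<^sub>m Suc n = A' ^\<^sub>m n * (A' * (A * A ^\<^sub>m n))"
    unfolding pow_mat_Suc_left[OF A] pow_mat.simps(2)[of A']
    by (rule assoc_mult_mat[OF c(1) A' mult_carrier_mat[OF A c(2)]])
  also have "A' * (A * A ^\<^sub>m n) = (A' * A) * A ^\<^sub>m n"
    by (rule assoc_mult_mat[OF A' A c(2), symmetric])
  also have "\<dots> = A ^\<^sub>m n" unfolding A'A by (rule left_mult_one_mat[OF c(2)])
  finally show ?case using Suc by simp
qed

lemma pow_cancel:
  assumes "a \<le> b"
  shows "A' ^\<^sub>m a * A ^\<^sub>m b = A ^\<^sub>m (b - a)"
proof -
  note c = pow_carrier_mat[OF A'] pow_carrier_mat[OF A]
  have "A' ^\<^sub>m a * A ^\<^sub>m b = A' ^\<^sub>m a * (A ^\<^sub>m a * A ^\<^sub>m (b - a))"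
    using assms by (simp flip: pow_mat_add[OF A])
  also have "\<dots> = (A' ^\<^sub>m a * A ^\<^sub>m a) * A ^\<^sub>m (b - a)"
    by (rule assoc_mult_mat[OF c(1) c(2) c(2), symmetric])
  finally show ?thesis unfolding pow_inverse using left_mult_one_mat[OF c(2)] by simp
qed

text \<open>Two powers of \<open>A\<close> agree modulo \<open>q\<close> by the pigeonhole
  principle, and multiplying by a power of \<open>A'\<close> cancels the smaller one.\<close>

lemma finite_order_mod:
  assumes q: "q > 0"
  obtains N B where "N > 0" "B \<in> carrier_mat d d" "A ^\<^sub>m N = 1\<^sub>m d + q \<cdot>\<^sub>m B"
proof -
  let ?f = "\<lambda>n. map_mat (\<lambda>x. x mod q) (A ^\<^sub>m n)"
  let ?S = "{M \<in> carrier_mat d d. \<forall>i<d. \<forall>j<d. M $$ (i, j) \<in> {0..<q}}"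
  have c: "A ^\<^sub>m n \<in> carrier_mat d d" "A' ^\<^sub>m n \<in> carrier_mat d d" for n
    using pow_carrier_mat[OF A] pow_carrier_mat[OF A'] .
  have "range ?f \<subseteq> ?S" using q carrier_matD[OF c(1)] c(1) by auto
  from finite_range_imp_repetition[OF finite_bounded_mats this]
  obtain a b where ab: "a < b" "?f a = ?f b" by auto
  define M where "M = mat d d (\<lambda>(i, j). ((A ^\<^sub>m b) $$ (i, j) - (A ^\<^sub>m a) $$ (i, j)) div q)"
  have M: "M \<in> carrier_mat d d" by (simp add: M_def)
  have "A ^\<^sub>m b = A ^\<^sub>m a + q \<cdot>\<^sub>m M"
  proof (rule eq_matI)
    fix i j assume "i < dim_row (A ^\<^sub>m a + q \<cdot>\<^sub>m M)" "j < dim_col (A ^\<^sub>m a + q \<cdot>\<^sub>m M)"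
    then have ij: "i < d" "j < d" by (simp_all add: M_def)
    have "(A ^\<^sub>m a) $$ (i, j) mod q = (A ^\<^sub>m b) $$ (i, j) mod q"
      using arg_cong[OF ab(2), of "\<lambda>M. M $$ (i, j)"] ij carrier_matD[OF A] by simp
    then have "q dvd (A ^\<^sub>m b) $$ (i, j) - (A ^\<^sub>m a) $$ (i, j)" by (metis mod_eq_dvd_iff)
    then show "(A ^\<^sub>m b) $$ (i, j) = (A ^\<^sub>m a + q \<cdot>\<^sub>m M) $$ (i, j)"
      using ij carrier_matD[OF A] by (simp add: M_def)
  qed (use carrier_matD[OF A] in \<open>auto simp: M_def\<close>)
  then have "A ^\<^sub>m (b - a) = A' ^\<^sub>m a * (A ^\<^sub>m a + q \<cdot>\<^sub>m M)"
    using pow_cancel[of a b] ab by simp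
  also have "\<dots> = A' ^\<^sub>m a * A ^\<^sub>m a + A' ^\<^sub>m a * (q \<cdot>\<^sub>m M)"
    using c M by (intro mult_add_distrib_mat[of _ d d]) auto
  also have "\<dots> = 1\<^sub>m d + q \<cdot>\<^sub>m (A' ^\<^sub>m a * M)"
    unfolding pow_inverse mult_smult_distrib[OF c(2) M] ..
  finally show thesis
    using ab mult_carrier_mat[OF c(2) M] by (intro that[of "b - a" "A' ^\<^sub>m a * M"]) auto
qed

text \<open>Column j is the k-th power of A^(N j), which is congruent to 1 modulo \<open>q\<close>,
  applied to the fixed vector A^(r j) b. The Leibniz formula passes from entries to the
  determinant.\<close>

lemma diff_div_det_krylov:
  assumes B: "B \<in> carrier_mat d d" "A ^\<^sub>m N = 1\<^sub>m d + q \<cdot>\<^sub>m B" and b: "b \<in> carrier_vec d"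
  shows "diff_div q 0 (\<lambda>k. det (krylov d (A ^\<^sub>m (r + N * k)) b))"
proof -
  have entry: "diff_div q 0 (\<lambda>k. krylov d (A ^\<^sub>m (r + N * k)) b $$ (i, j))" if ij: "i < d" "j < d" for i j
  proof -
    obtain B' where B': "B' \<in> carrier_mat d d" "A ^\<^sub>m (N * j) = 1\<^sub>m d + q \<cdot>\<^sub>m B'"
      using pow_mat_one_plus[OF B(1), of q j] unfolding B(2)[symmetric] pow_mat_mult[OF A] by blast
    let ?c = "A ^\<^sub>m (r * j) *\<^sub>v b"
    have c: "?c \<in> carrier_vec d" by (rule mult_mat_vec_carrier[OF pow_carrier_mat[OF A] b])
    have "krylov d (A ^\<^sub>m (r + N * k)) b $$ (i, j) = ((1\<^sub>m d + q \<cdot>\<^sub>m B') ^\<^sub>m k *\<^sub>v ?c) $ i" for k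
    proof -
      have "(r + N * k) * j = N * j * k + r * j" by (simp add: algebra_simps)
      then have "A ^\<^sub>m ((r + N * k) * j) *\<^sub>v b = (A ^\<^sub>m (N * j * k) * A ^\<^sub>m (r * j)) *\<^sub>v b"
        by (simp only: pow_mat_add[OF A])
      also have "\<dots> = A ^\<^sub>m (N * j * k) *\<^sub>v ?c"
        by (rule assoc_mult_mat_vec[OF pow_carrier_mat[OF A] pow_carrier_mat[OF A] b])
      finally show ?thesis
        unfolding B'(2)[symmetric] pow_mat_mult[OF A] using ij
        by (simp add: krylov_def pow_mat_mult[OF A] del: index_mult_mat_vec)
    qed
    then show ?thesis using diff_div_pow_mat_entry[OF B'(1) c ij(1), of q] by simp
  qed
  have "diff_div q 0 (\<lambda>k. signof p * (\<Prod>i = 0..<d. krylov d (A ^\<^sub>m (r + N * k)) b $$ (i, p i)))"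
    if "p permutes {0..<d}" for p
  proof -
    have "diff_div q 0 (\<lambda>k. \<Prod>i = 0..<d. krylov d (A ^\<^sub>m (r + N * k)) b $$ (i, p i))"
      using permutes_in_image[OF that] by (intro diff_div_prod entry) auto
    from diff_div_mult[OF diff_div_const this] show ?thesis by simp
  qed
  then show ?thesis
    unfolding det_def'[OF krylov_carrier]
    by (intro diff_div_sum) (auto simp: finite_permutations)
qed

text \<open>Some residue class modulo \<open>N\<close> contains infinitely many of the given n. On
  it, the squared determinant minus 1 has infinitely many zeros, hence vanishes identically.\<close>

lemma det_krylov_constant_on_progression:
  assumes b: "b \<in> carrier_vec d" and inf: "infinite {n. \<bar>det (krylov d (A ^\<^sub>m n) b)\<bar> = 1}"
  obtains N r where "N > 0" "\<And>k. \<bar>det (krylov d (A ^\<^sub>m (r + N * k)) b)\<bar> = 1"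
proof -
  let ?D = "\<lambda>n. det (krylov d (A ^\<^sub>m n) b)"
  obtain N B where N: "N > 0" "B \<in> carrier_mat d d" "A ^\<^sub>m N = 1\<^sub>m d + 4 \<cdot>\<^sub>m B"
    using finite_order_mod[of 4] by auto
  have "finite ((\<lambda>n. n mod N) ` {n. \<bar>?D n\<bar> = 1})"
    by (rule finite_subset[of _ "{..<N}"]) (use N in auto)
  from pigeonhole_infinite[OF inf this] obtain a where
    a: "infinite {n \<in> {n. \<bar>?D n\<bar> = 1}. n mod N = a mod N}" by auto
  define r where "r = a mod N"
  let ?S = "{n. \<bar>?D n\<bar> = 1 \<and> n mod N = r}"
  let ?g = "\<lambda>k. ?D (r + N * k) * ?D (r + N * k) + - 1"
  have "infinite ?S" using a by (simp add: r_def)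
  moreover have "?S \<subseteq> (\<lambda>k. r + N * k) ` {k. ?g k = 0}"
  proof
    fix n assume n: "n \<in> ?S"
    then have "n = r + N * (n div N)" by (metis (mono_tags, lifting) mem_Collect_eq mod_mult_div_eq)
    moreover have "?D n * ?D n + - 1 = 0"
      using n by (simp add: int_abs_eq_1_iff)
    ultimately show "n \<in> (\<lambda>k. r + N * k) ` {k. ?g k = 0}"
      by (intro image_eqI[of _ _ "n div N"]) simp_all
  qed
  ultimately have inf': "infinite {k. ?g k = 0}" by (meson finite_imageI finite_subset)
  have D: "diff_div 4 0 (\<lambda>k. ?D (r + N * k))" by (rule diff_div_det_krylov[OF N(2,3) b])
  have "diff_div 4 0 ?g"
    using diff_div_mult[OF D D] by (intro diff_div_add diff_div_const) simp
  then have "?g k = 0" for k using diff_div_infinite_zeros inf' by blast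
  then have "\<bar>?D (r + N * k)\<bar> = 1" for k
    unfolding int_abs_eq_1_iff .
  then show thesis using N(1) that by blast
qed

lemma det_unit: "\<bar>det A\<bar> = 1"
proof -
  have "1 = det A * det A'" using det_mult[OF A A'] AA' by simp
  then have "det A dvd 1" by (rule dvdI)
  then show ?thesis by simp
qed

text \<open>Only finitely many integer matrices obey the bound, so two powers coincide, and
  invertibility cancels one of them.\<close>

theorem bounded_powers_finite_order:
  assumes "\<And>n i j. i < d \<Longrightarrow> j < d \<Longrightarrow> \<bar>(A ^\<^sub>m n) $$ (i, j)\<bar> \<le> c"
  obtains k where "k > 0" "A ^\<^sub>m k = 1\<^sub>m d"
proof -
  have "range (\<lambda>n. A ^\<^sub>m n) \<subseteq> {M \<in> carrier_mat d d. \<forall>i<d. \<forall>j<d. M $$ (i, j) \<in> {- c..c}}"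
    using assms pow_carrier_mat[OF A] by (auto simp: abs_le_iff minus_le_iff)
  from finite_range_imp_repetition[OF finite_bounded_mats this]
  obtain a b where ab: "a < b" "A ^\<^sub>m a = A ^\<^sub>m b" by auto
  have "A ^\<^sub>m (b - a) = 1\<^sub>m d" using pow_cancel[of a b] pow_inverse[of a] ab by simp
  then show thesis using ab that[of "b - a"] by simp
qed

theorem infinitely_many_unimodular_imp_finite_order:
  assumes inf: "infinite {n. \<exists>b\<in>carrier_vec d. \<bar>det (krylov d (A ^\<^sub>m n) b)\<bar> = 1}"
  obtains k where "k > 0" "A ^\<^sub>m k = 1\<^sub>m d"
proof -
  let ?c = "map_mat of_int :: int mat \<Rightarrow> complex mat"
  have cA: "?c A \<in> carrier_mat d d" using A by simp
  obtain es where es: "char_poly (?c A) = (\<Prod>a\<leftarrow>es. [:- a, 1:])" "length es = d"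
    using char_poly_factorized[OF cA] by blast
  define W where "W n = (\<Prod>i<d. \<Prod>j<i. hom_sum n (es ! i) (es ! j))" for n
  have W: "of_int (det (krylov d (A ^\<^sub>m n) b)) = W n * of_int (det (krylov d A b))"
    if b: "b \<in> carrier_vec d" for n b
  proof -
    have hom: "?c (krylov d M b) = krylov d (?c M) (map_vec of_int b)" if M: "M \<in> carrier_mat d d" for M
    proof (rule eq_matI)
      fix i j assume "i < dim_row (krylov d (?c M) (map_vec of_int b))" "j < dim_col (krylov d (?c M) (map_vec of_int b))"
      then have ij: "i < d" "j < d" by (simp_all add: krylov_def)
      have "?c M ^\<^sub>m j *\<^sub>v map_vec of_int b = map_vec of_int (M ^\<^sub>m j *\<^sub>v b)"
        using M b by (simp add: of_int_hom.mult_mat_vec_hom[of _ d d] of_int_hom.mat_hom_pow)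
      then show "?c (krylov d M b) $$ (i, j) = krylov d (?c M) (map_vec of_int b) $$ (i, j)"
        using ij M by (simp add: krylov_def del: index_mult_mat_vec)
    qed (simp_all add: krylov_def)
    have "of_int (det (krylov d (A ^\<^sub>m n) b)) = det (krylov d (?c A ^\<^sub>m n) (map_vec of_int b))"
      using hom[OF pow_carrier_mat[OF A, of n]] of_int_hom.mat_hom_pow[OF A, of n] of_int_hom.hom_det by metis
    also have "\<dots> = W n * det (krylov d (?c A) (map_vec of_int b))"
      unfolding W_def using b by (intro det_krylov_pow[OF cA es(1)]) simp
    also have "det (krylov d (?c A) (map_vec of_int b)) = of_int (det (krylov d A b))"
      using hom[OF A] of_int_hom.hom_det by metis
    finally show ?thesis .
  qed
  \<comment> \<open>By divisibility, a \<open>b\<close> that is unimodular for A^n is unimodular for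
    \<open>A\<close>; this forces \<open>W n\<close> to have modulus 1.\<close>
  have unit1: "\<bar>det (krylov d A b)\<bar> = 1" if "b \<in> carrier_vec d" "\<bar>det (krylov d (A ^\<^sub>m n) b)\<bar> = 1" for b n
    using det_krylov_dvd_det_krylov_pow[OF A that(1), of n] that(2) by (metis dvd_abs_iff zdvd1_eq abs_abs)
  have normW: "cmod (W n) = 1" if b: "b \<in> carrier_vec d" "\<bar>det (krylov d (A ^\<^sub>m n) b)\<bar> = 1" for b n
  proof -
    have "cmod (of_int (det (krylov d (A ^\<^sub>m n) b))) = cmod (W n) * cmod (of_int (det (krylov d A b)))"
      unfolding W[OF b(1)] by (rule norm_mult)
    then show ?thesis using b(2) unit1[OF b] by (simp add: norm_of_int flip: of_int_abs)
  qed
  \<comment> \<open>From here on \<open>b\<close> is fixed: the modulus of its determinant for A^n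
    is that of \<open>W n\<close>, so it is unimodular for every n in the infinite set.\<close>
  obtain n0 b where b: "b \<in> carrier_vec d" "\<bar>det (krylov d (A ^\<^sub>m n0) b)\<bar> = 1"
    using infinite_imp_nonempty[OF inf] by blast
  have det_W: "real_of_int \<bar>det (krylov d (A ^\<^sub>m n) b)\<bar> = cmod (W n)" for n
  proof -
    have "cmod (of_int (det (krylov d (A ^\<^sub>m n) b))) = cmod (W n) * cmod (of_int (det (krylov d A b)))"
      unfolding W[OF b(1)] by (rule norm_mult)
    then show ?thesis using unit1[OF b] by (simp add: norm_of_int flip: of_int_abs)
  qed
  have "{n. \<exists>b\<in>carrier_vec d. \<bar>det (krylov d (A ^\<^sub>m n) b)\<bar> = 1} \<subseteq> {n. \<bar>det (krylov d (A ^\<^sub>m n) b)\<bar> = 1}"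
  proof
    fix n assume "n \<in> {n. \<exists>b\<in>carrier_vec d. \<bar>det (krylov d (A ^\<^sub>m n) b)\<bar> = 1}"
    then have "cmod (W n) = 1" using normW by blast
    then have "real_of_int \<bar>det (krylov d (A ^\<^sub>m n) b)\<bar> = 1" using det_W by simp
    then show "n \<in> {n. \<bar>det (krylov d (A ^\<^sub>m n) b)\<bar> = 1}"
      unfolding of_int_eq_1_iff by blast
  qed
  then have "infinite {n. \<bar>det (krylov d (A ^\<^sub>m n) b)\<bar> = 1}" using inf finite_subset by blast
  from det_krylov_constant_on_progression[OF b(1) this]
  obtain N r where N: "N > 0" "\<And>k. \<bar>det (krylov d (A ^\<^sub>m (r + N * k)) b)\<bar> = 1" by blast
  have W1: "cmod (\<Prod>i<d. \<Prod>j<i. hom_sum (r + N * k) (es ! i) (es ! j)) = 1" for k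
    using det_W[of "r + N * k"] N(2)[of k] unfolding W_def by simp
  have prod1: "(\<Prod>i<d. cmod (es ! i)) = 1"
  proof -
    obtain L P Q where L: "similar_mat_wit (?c A) L P Q" "lower_tri d L" "\<And>i. i < d \<Longrightarrow> L $$ (i, i) = es ! i"
      using lower_triangularization[OF cA es(1)] by blast
    have "det (?c A) = det L" using L(1) by (intro det_similar) (auto simp: similar_mat_def)
    also have "\<dots> = prod_list (diag_mat L)"
      using L(2) by (intro det_lower_triangular[of d]) (auto simp: lower_tri_def)
    also have "diag_mat L = map (\<lambda>i. es ! i) [0..<d]"
      using L(3) lower_tri_carrier[OF L(2)] by (auto simp: diag_mat_def)
    also have "prod_list \<dots> = (\<Prod>i<d. es ! i)"
      by (simp add: prod.distinct_set_conv_list[symmetric] lessThan_atLeast0)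
    finally have "cmod (\<Prod>i<d. es ! i) = cmod (of_int (det A))"
      by (simp add: of_int_hom.hom_det)
    then show ?thesis using det_unit by (simp add: prod_norm flip: of_int_abs)
  qed
  note growth = hom_sum_product_growth[OF N(1) prod1 W1]
  have "distinct es"
    unfolding distinct_conv_nth using growth(1) es(2) by (auto dest: inj_onD)
  \<comment> \<open>Multiplicities are at most 1, so the growth exponent is 1 - 1 = 0 and the powers
    are bounded.\<close>
  have "\<exists>c1 c2. \<forall>k. norm_bound (?c A ^\<^sub>m k) (c1 + c2 * of_nat k ^ (1 - 1))"
  proof (rule factored_char_poly_norm_bound_cof[OF cA es(1)])
    show "norm a \<le> 1" if "a \<in> set es" for a
      using that growth(2) es(2) by (auto simp: in_set_conv_nth)
    show "length (filter ((=) a) es) \<le> 1" for a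
      using \<open>distinct es\<close> distinct_length_filter[of es "(=) a"] by (simp add: card_le_Suc0_iff_eq)
  qed
  then obtain c1 c2 where nb: "\<And>k. norm_bound (?c A ^\<^sub>m k) (c1 + c2)" by auto
  have "\<bar>(A ^\<^sub>m n) $$ (i, j)\<bar> \<le> \<lfloor>c1 + c2\<rfloor>" if "i < d" "j < d" for n i j
  proof -
    have "(?c A ^\<^sub>m n) $$ (i, j) = of_int ((A ^\<^sub>m n) $$ (i, j))"
      using that carrier_matD[OF A] unfolding of_int_hom.mat_hom_pow[OF A, symmetric] by simp
    then have "cmod (of_int ((A ^\<^sub>m n) $$ (i, j))) \<le> c1 + c2"
      using nb[of n] that carrier_matD[OF pow_carrier_mat[OF cA, of n]] unfolding norm_bound_def by metis
    then show ?thesis by (simp add: le_floor_iff)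
  qed
  from bounded_powers_finite_order[OF this] show thesis using that by blast
qed

end

section \<open>The rank bound for the groups G_n\<close>

theorem theorem1p4:
  fixes d :: nat and \<phi> :: "int mat"
  assumes "d \<ge> 2"
    and "\<phi> \<in> carrier (GL_int d)"
    and "\<forall>k::nat. k > 0 \<longrightarrow> \<phi> [^]\<^bsub>GL_int d\<^esub> k \<noteq> \<one>\<^bsub>GL_int d\<^esub>"
  shows "\<exists>n\<^sub>0::nat. \<forall>n\<ge>n\<^sub>0.
    group_rank (semidirect_int (monoid_vec TYPE(int) d)
      (mat_automorphism d (\<phi> [^]\<^bsub>GL_int d\<^esub> n))) \<ge> 3"
proof -
  obtain \<phi>' where \<phi>: "\<phi> \<in> carrier_mat d d" "\<phi>' \<in> carrier_mat d d" "\<phi> * \<phi>' = 1\<^sub>m d" "\<phi>' * \<phi> = 1\<^sub>m d"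
    using assms(2) by (auto simp: GL_int_def units_of_def Units_def ring_mat_simps)
  have pow: "\<phi> [^]\<^bsub>GL_int d\<^esub> (n :: nat) = \<phi> ^\<^sub>m n" for n
    using \<phi>(1) by (induction n) (simp_all add: GL_int_def units_of_def ring_mat_simps)
  interpret P: int_mat_pair d \<phi> \<phi>' by unfold_locales (fact \<phi>)+
  have pair: "int_mat_pair d (\<phi> ^\<^sub>m n) (\<phi>' ^\<^sub>m n)" for n
  proof
    \<comment> \<open>Exchanging the two matrices gives the product in the other order.\<close>
    interpret P': int_mat_pair d \<phi>' \<phi> by unfold_locales (fact \<phi>)+
    show "\<phi> ^\<^sub>m n * \<phi>' ^\<^sub>m n = 1\<^sub>m d" by (rule P'.pow_inverse)
    show "\<phi>' ^\<^sub>m n * \<phi> ^\<^sub>m n = 1\<^sub>m d" by (rule P.pow_inverse)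
  qed (use \<phi> in auto)
  let ?G = "\<lambda>n. semidirect_int (monoid_vec TYPE(int) d) (mat_automorphism d (\<phi> ^\<^sub>m n))"
  have "finite {n. group_rank (?G n) < 3}"
  proof (rule ccontr)
    assume inf: "infinite {n. group_rank (?G n) < 3}"
    have "{n. group_rank (?G n) < 3} \<subseteq> {n. \<exists>b\<in>carrier_vec d. \<bar>det (krylov d (\<phi> ^\<^sub>m n) b)\<bar> = 1}"
      using int_mat_pair.small_rank_imp_unimodular_krylov[OF pair] assms(1) by auto
    then have "infinite {n. \<exists>b\<in>carrier_vec d. \<bar>det (krylov d (\<phi> ^\<^sub>m n) b)\<bar> = 1}"
      using inf finite_subset by blast
    from P.infinitely_many_unimodular_imp_finite_order[OF this]
    obtain k where "k > 0" "\<phi> ^\<^sub>m k = 1\<^sub>m d" by blast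
    then show False using assms(3) pow by (simp add: GL_int_def units_of_def ring_mat_simps)
  qed
  then obtain m where "\<And>n. group_rank (?G n) < 3 \<Longrightarrow> n \<le> m"
    by (auto simp: finite_nat_set_iff_bounded_le)
  \<comment> \<open>The bound \<open>m\<close> includes the last possible exception, so the
    threshold is \<open>Suc m\<close>.\<close>
  then show ?thesis unfolding pow by (intro exI[of _ "Suc m"]) (meson not_less_eq_eq not_less)
qed

end
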